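(* Let $\alpha_1$ be a nonzero algebraic number and let $\alpha_2,\dots,\alpha_k$ be all the other Galois conjugates of $\alpha_1$, where $k\ge2$. Let $K$ be the Galois closure of $\mathbb{Q}(\alpha_1)$ and $d=[K:\mathbb{Q}]$ (so $d\ge k$). Let $b_1,\dots,b_k$ be integers (not necessarily distinct) with $b_1+\cdots+b_k=n\neq0$. If $$\mathrm{Tr}_{K/\mathbb{Q}}(b_1\alpha_1^j+\cdots+b_k\alpha_k^j)\in\mathbb{Z}\quad\text{for all } j=1,2,\dots,d+d\lfloor\log_2(|n|d)\rfloor+1,$$ then $\alpha_1$ is an algebraic integer, and hence so is each $\alpha_j$, $j\ge2$.
   Context: $\mathrm{Tr}_{K/\mathbb{Q}}$ is the field trace and $\lfloor\cdot\rfloor$ the integer part. *)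

theory Defs
  imports "HOL-Analysis.Analysis" "HOL-Computational_Algebra.Computational_Algebra"
begin

definition is_subfield :: "complex set \<Rightarrow> bool" where
  "is_subfield F \<longleftrightarrow> 0 \<in> F \<and> 1 \<in> F \<and>
     (\<forall>x\<in>F. \<forall>y\<in>F. x + y \<in> F \<and> x * y \<in> F) \<and>
     (\<forall>x\<in>F. - x \<in> F \<and> inverse x \<in> F)"

definition field_generated :: "complex set \<Rightarrow> complex set" where
  "field_generated S = \<Inter>{F. is_subfield F \<and> S \<subseteq> F}"

definition min_poly_rat :: "complex \<Rightarrow> rat poly" where
  "min_poly_rat a = (THE p. lead_coeff p = 1 \<and> irreducible p \<and> poly (map_poly of_rat p) a = 0)"

definition galois_conjugates :: "complex \<Rightarrow> complex set" where
  "galois_conjugates a = {z. poly (map_poly of_rat (min_poly_rat a)) z = 0}"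

definition galois_closure :: "complex \<Rightarrow> complex set" where
  "galois_closure a = field_generated (galois_conjugates a)"

definition field_degree :: "complex set \<Rightarrow> nat" where
  "field_degree K = vector_space.dim (\<lambda>(r::rat) (x::complex). of_rat r * x) K"

text \<open>Field embeddings K \<rightarrow> \<complex> (ring homomorphisms; they automatically fix \<rat>),
  normalised to be 0 outside K so that the set is finite for number fields.\<close>
definition field_embeddings :: "complex set \<Rightarrow> (complex \<Rightarrow> complex) set" where
  "field_embeddings K = {\<sigma>. (\<forall>x\<in>K. \<forall>y\<in>K. \<sigma> (x + y) = \<sigma> x + \<sigma> y \<and> \<sigma> (x * y) = \<sigma> x * \<sigma> y)
      \<and> \<sigma> 1 = 1 \<and> (\<forall>x. x \<notin> K \<longrightarrow> \<sigma> x = 0)}"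

text \<open>Trace Tr_{K/\<rat>}(x) = sum of the images of x under all embeddings of K into \<complex>
  (K/\<rat> is separable).\<close>
definition field_trace :: "complex set \<Rightarrow> complex \<Rightarrow> complex" where
  "field_trace K x = (\<Sum>\<sigma>\<in>field_embeddings K. \<sigma> x)"

end

theory Submission
  imports Defs
begin

text \<open>
  The embeddings of the Galois closure permute the conjugates transitively, so with
  \<open>P\<^sub>j = \<alpha>\<^sub>1\<^sup>j + \<dots> + \<alpha>\<^sub>k\<^sup>j\<close> the trace in question is \<open>N P\<^sub>j\<close>, where \<open>N = n m\<close> and \<open>m k \<le> d\<close> is the number of
  embeddings.

  Suppose a conjugate is not integral and choose a valuation ring \<open>O\<close> of the complex numbers that
  avoids it. Let \<open>a\<close> be a conjugate of largest value and put \<open>u\<^sub>i = \<alpha>\<^sub>i / a \<in> O\<close>. If \<open>N P\<^sub>j\<close> is an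
  integer for \<open>k\<close> consecutive exponents starting with \<open>J\<close>, the linear recurrence of the power sums
  of the \<open>u\<^sub>i\<close> shows that \<open>a\<close> to the power \<open>-J\<close> divides \<open>N \<Sum> u\<^sub>i\<^sup>J h(u\<^sub>i)\<close> for all polynomials \<open>h\<close> over \<open>O\<close>.
  A suitable \<open>h\<close> makes this sum count the \<open>r\<close> units among the \<open>u\<^sub>i\<close>, so \<open>N r\<close> is divisible by that power.
  As some coefficient of the minimal polynomial equals \<open>a\<^sup>i\<close> times a unit with \<open>1 \<le> i \<le> k\<close>, the
  residue characteristic \<open>p\<close> divides \<open>a\<close> to the power \<open>-k\<close>. With \<open>J = k v + 1\<close> this forces
  \<open>p\<close> to the power \<open>v + 1\<close> to divide \<open>N r\<close>, which is too small for that when \<open>v = \<lfloor>log\<^sub>2 (|n| d)\<rfloor>\<close>.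
\<close>

subsection \<open>Subrings and adjunction\<close>

text \<open>Subrings are plain subsets of the ambient ring, so that Zorn's lemma can later range
  over all subrings of one fixed field.\<close>

definition is_subring :: "'a::comm_ring_1 set \<Rightarrow> bool" where
  "is_subring R \<longleftrightarrow> 1 \<in> R \<and> (\<forall>x\<in>R. \<forall>y\<in>R. x + y \<in> R \<and> x * y \<in> R) \<and> (\<forall>x\<in>R. - x \<in> R)"

definition poly_over :: "'a::comm_ring_1 set \<Rightarrow> 'a poly set" where
  "poly_over R = {h. \<forall>i. coeff h i \<in> R}"

definition adjoin :: "'a::comm_ring_1 set \<Rightarrow> 'a \<Rightarrow> 'a set" where
  "adjoin R x = (\<lambda>h. poly h x) ` poly_over R"

locale subring_set =
  fixes R :: "'a::comm_ring_1 set"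
  assumes subring: "is_subring R"
begin

lemma one_mem [simp]: "1 \<in> R"
  and add_mem: "x \<in> R \<Longrightarrow> y \<in> R \<Longrightarrow> x + y \<in> R"
  and mult_mem: "x \<in> R \<Longrightarrow> y \<in> R \<Longrightarrow> x * y \<in> R"
  and uminus_mem: "x \<in> R \<Longrightarrow> - x \<in> R"
  using subring by (auto simp: is_subring_def)

lemma zero_mem [simp]: "0 \<in> R"
  using add_mem[OF one_mem uminus_mem[OF one_mem]] by simp

lemma diff_mem: "x \<in> R \<Longrightarrow> y \<in> R \<Longrightarrow> x - y \<in> R"
  using add_mem[of x "- y"] uminus_mem[of y] by simp

lemma sum_mem: "(\<And>i. i \<in> I \<Longrightarrow> f i \<in> R) \<Longrightarrow> sum f I \<in> R"
  by (induction I rule: infinite_finite_induct) (auto intro: add_mem)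

lemma power_mem: "x \<in> R \<Longrightarrow> x ^ n \<in> R"
  by (induction n) (auto intro: mult_mem)

lemma of_nat_mem: "of_nat n \<in> R"
  by (induction n) (auto intro: add_mem)

lemma of_int_mem: "of_int n \<in> R"
  by (cases n) (auto simp del: of_nat_Suc intro: of_nat_mem uminus_mem)

lemma Ints_subset: "\<int> \<subseteq> R"
  by (auto elim!: Ints_cases intro: of_int_mem)

lemma poly_over_add: "p \<in> poly_over R \<Longrightarrow> q \<in> poly_over R \<Longrightarrow> p + q \<in> poly_over R"
  by (auto simp: poly_over_def intro: add_mem)

lemma poly_over_uminus: "p \<in> poly_over R \<Longrightarrow> - p \<in> poly_over R"
  by (auto simp: poly_over_def intro: uminus_mem)

lemma poly_over_diff: "p \<in> poly_over R \<Longrightarrow> q \<in> poly_over R \<Longrightarrow> p - q \<in> poly_over R"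
  by (auto simp: poly_over_def intro: diff_mem)

lemma poly_over_mult: "p \<in> poly_over R \<Longrightarrow> q \<in> poly_over R \<Longrightarrow> p * q \<in> poly_over R"
  by (auto simp: poly_over_def coeff_mult intro!: sum_mem mult_mem)

lemma poly_over_smult: "c \<in> R \<Longrightarrow> p \<in> poly_over R \<Longrightarrow> smult c p \<in> poly_over R"
  by (auto simp: poly_over_def intro: mult_mem)

lemma poly_over_monom: "c \<in> R \<Longrightarrow> monom c n \<in> poly_over R"
  by (auto simp: poly_over_def)

lemma poly_over_pCons: "c \<in> R \<Longrightarrow> p \<in> poly_over R \<Longrightarrow> pCons c p \<in> poly_over R"
  by (auto simp: poly_over_def coeff_pCons split: nat.split)

lemma poly_over_0: "0 \<in> poly_over R"
  by (auto simp: poly_over_def)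

lemma poly_over_1: "1 \<in> poly_over R"
  by (auto simp: poly_over_def coeff_1)

lemma poly_over_prod: "(\<And>i. i \<in> I \<Longrightarrow> f i \<in> poly_over R) \<Longrightarrow> prod f I \<in> poly_over R"
  by (induction I rule: infinite_finite_induct) (auto intro: poly_over_mult poly_over_1)

lemma poly_mem: "p \<in> poly_over R \<Longrightarrow> x \<in> R \<Longrightarrow> poly p x \<in> R"
  by (auto simp: poly_altdef poly_over_def intro!: sum_mem mult_mem power_mem)

lemma adjoin_subring: "is_subring (adjoin R x)"
  unfolding is_subring_def
proof (intro conjI ballI)
  show "1 \<in> adjoin R x"
    unfolding adjoin_def using poly_over_1 by (intro image_eqI[of _ _ 1]) auto
next
  fix a b assume "a \<in> adjoin R x" "b \<in> adjoin R x"
  then obtain p q where "p \<in> poly_over R" "q \<in> poly_over R" "a = poly p x" "b = poly q x"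
    by (auto simp: adjoin_def)
  then have "a + b = poly (p + q) x" "a * b = poly (p * q) x"
      "p + q \<in> poly_over R" "p * q \<in> poly_over R"
    by (auto intro: poly_over_add poly_over_mult)
  then show "a + b \<in> adjoin R x" "a * b \<in> adjoin R x"
    unfolding adjoin_def by (blast intro: image_eqI)+
next
  fix a assume "a \<in> adjoin R x"
  then obtain p where "p \<in> poly_over R" "a = poly p x" by (auto simp: adjoin_def)
  then have "- a = poly (- p) x" "- p \<in> poly_over R" by (auto intro: poly_over_uminus)
  then show "- a \<in> adjoin R x" unfolding adjoin_def by (rule image_eqI)
qed

lemma adjoin_subset: "R \<subseteq> adjoin R x"
proof
  fix c assume "c \<in> R"
  then have "[:c:] \<in> poly_over R" by (intro poly_over_pCons poly_over_0)
  then show "c \<in> adjoin R x" unfolding adjoin_def by (intro image_eqI[of _ _ "[:c:]"]) auto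
qed

lemma adjoin_mem: "x \<in> adjoin R x"
  unfolding adjoin_def
  by (intro image_eqI[of _ _ "[:0, 1:]"] poly_over_pCons poly_over_0) auto

lemma adjoin_least:
  assumes "is_subring S" "R \<subseteq> S" "x \<in> S"
  shows "adjoin R x \<subseteq> S"
proof -
  interpret S: subring_set S by unfold_locales fact
  show ?thesis
    using assms by (auto simp: adjoin_def intro!: S.poly_mem) (auto simp: poly_over_def)
qed

end

subsection \<open>Valuation rings avoiding a non-integral element\<close>

lemma subring_Ints: "is_subring \<int>"
  by (auto simp: is_subring_def)

text \<open>Multiplying a = h(1/a) by \<open>a ^ n\<close>, with \<open>n\<close> the degree of
  \<open>h\<close>, gives a monic integral equation of degree n + 1. So for non-integral
  \<open>a\<close> the ring generated by 1/a avoids \<open>a\<close>, which starts the Zorn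
  argument.\<close>

lemma algebraic_int_if_mem_adjoin_inverse:
  fixes a :: "'a::field"
  assumes "a \<in> adjoin \<int> (inverse a)"
  shows "algebraic_int a"
proof (cases "a = 0")
  case False
  obtain h where h: "h \<in> poly_over \<int>" "a = poly h (inverse a)"
    using assms by (auto simp: adjoin_def)
  define n where "n = degree h"
  \<comment> \<open>The subtracted sum is X^n h(1/X), that is, \<open>h\<close> with reversed
    coefficients.\<close>
  define g where "g = monom 1 (Suc n) - (\<Sum>i\<le>n. monom (coeff h i) (n - i))"
  have c: "coeff (\<Sum>i\<le>n. monom (coeff h i) (n - i)) j = (if j \<le> n then coeff h (n - j) else 0)" for j
  proof -
    have "coeff (\<Sum>i\<le>n. monom (coeff h i) (n - i)) j = (\<Sum>i\<le>n. if n - i = j then coeff h i else 0)"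
      by (simp add: coeff_sum)
    also have "\<dots> = (\<Sum>i\<le>n. if i = n - j \<and> j \<le> n then coeff h i else 0)"
      by (intro sum.cong) auto
    finally show ?thesis by auto
  qed
  have "coeff g (Suc n) = 1" "\<And>j. j > Suc n \<Longrightarrow> coeff g j = 0"
    by (auto simp: g_def c)
  then have "degree g = Suc n"
    by (intro antisym degree_le le_degree) auto
  then have lead: "lead_coeff g = 1" using \<open>coeff g (Suc n) = 1\<close> by simp
  have int: "\<forall>i. coeff g i \<in> \<int>"
    using h(1) by (auto simp: g_def c poly_over_def)
  have "a ^ Suc n = a ^ n * poly h (inverse a)" using h(2) by simp
  also have "\<dots> = (\<Sum>i\<le>n. coeff h i * a ^ (n - i))"
    unfolding poly_altdef n_def[symmetric] sum_distrib_left
    using False by (intro sum.cong) (auto simp: power_diff power_inverse field_simps)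
  finally have "poly g a = 0"
    by (simp add: g_def poly_sum poly_monom)
  then show ?thesis using lead int by (intro algebraic_int.intros)
qed (auto intro: algebraic_int.intros[of "[:0,1:]"] simp: coeff_pCons split: nat.split)

text \<open>If adjoining 1/s for \<open>s = 1 - inverse a * b\<close> produced \<open>a\<close>,
  clearing denominators would put \<open>s ^ n * a\<close> into \<open>R\<close>, although it
  differs from \<open>a\<close> by an element of \<open>R\<close>. Maximality then forces 1/s into
  \<open>R\<close>. In other words, 1/a lies in the Jacobson radical of \<open>R\<close>.\<close>

lemma maximal_subring_unit:
  fixes R :: "'a::field set"
  assumes R: "is_subring R" and a: "inverse a \<in> R" "a \<notin> R"
    and max: "\<And>S. is_subring S \<Longrightarrow> R \<subseteq> S \<Longrightarrow> a \<notin> S \<Longrightarrow> S = R"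
    and b: "b \<in> R"
  shows "inverse (1 - inverse a * b) \<in> R"
proof -
  interpret subring_set R by unfold_locales fact
  define s where "s = 1 - inverse a * b"
  have a0: "a \<noteq> 0" using a(2) by auto
  have s: "s \<in> R" using a b by (auto simp: s_def intro!: diff_mem mult_mem)
  have s0: "s \<noteq> 0"
  proof
    assume "s = 0"
    then have "a = b" using a0 by (auto simp: s_def field_simps)
    with a b show False by simp
  qed
  \<comment> \<open>Powers of \<open>s\<close> stay congruent to 1 modulo the ideal generated by
    \<open>inverse a\<close>; multiplied by \<open>a\<close> they give \<open>a\<close> up to an
    element of \<open>R\<close>.\<close>
  have spow: "\<exists>c\<in>R. s ^ n = 1 - inverse a * c" for n
  proof (induction n)
    case 0
    show ?case by (intro bexI[of _ 0]) auto
  next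
    case (Suc n)
    then obtain c where c: "c \<in> R" "s ^ n = 1 - inverse a * c" by auto
    have "s ^ Suc n = 1 - inverse a * (c + b - inverse a * b * c)"
      unfolding power_Suc c(2) by (simp add: s_def algebra_simps)
    then show ?case
      by (intro bexI[of _ "c + b - inverse a * b * c"])
        (auto intro!: add_mem diff_mem mult_mem a b c)
  qed
  have "a \<notin> adjoin R (inverse s)"
  proof
    assume "a \<in> adjoin R (inverse s)"
    then obtain h where h: "h \<in> poly_over R" "a = poly h (inverse s)" by (auto simp: adjoin_def)
    define n where "n = degree h"
    obtain c where c: "c \<in> R" "s ^ n = 1 - inverse a * c" using spow by blast
    define e where "e = (\<Sum>i\<le>n. coeff h i * s ^ (n - i))"
    have e: "e \<in> R" using h s by (auto simp: e_def poly_over_def intro!: sum_mem mult_mem power_mem)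
    have "s ^ n * a = e"
      unfolding h(2) poly_altdef n_def[symmetric] sum_distrib_left e_def
      using s0 by (intro sum.cong) (auto simp: power_diff power_inverse field_simps)
    moreover have "s ^ n * a = a - c" unfolding c(2) using a0 by (simp add: field_simps)
    ultimately have "a = e + c" by (simp add: algebra_simps)
    then show False using a c e by (auto intro: add_mem)
  qed
  then have "adjoin R (inverse s) = R"
    by (intro max adjoin_subring adjoin_subset)
  then show ?thesis using adjoin_mem[of "inverse s"] by (simp add: s_def)
qed

text \<open>The representation of \<open>a\<close> by 1/x is solved for \<open>x ^ n\<close>, with
  \<open>n\<close> the degree of \<open>h\<close>; substituting the result for the leading power in
  \<open>h\<close> lowers the degree.\<close>

lemma maximal_subring_degree_descent:
  fixes R :: "'a::field set"
  assumes R: "is_subring R" and a: "inverse a \<in> R" "a \<notin> R"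
    and max: "\<And>S. is_subring S \<Longrightarrow> R \<subseteq> S \<Longrightarrow> a \<notin> S \<Longrightarrow> S = R"
    and h: "h \<in> poly_over R" "poly h x = a" and g: "g \<in> poly_over R" "poly g (inverse x) = a"
    and le: "degree g \<le> degree h" and x: "x \<noteq> 0"
  shows "\<exists>h'\<in>poly_over R. poly h' x = a \<and> degree h' < degree h"
proof -
  interpret subring_set R by unfold_locales fact
  define n where "n = degree h"
  define b where "b = coeff g 0"
  have b: "b \<in> R" and gR: "\<And>i. coeff g i \<in> R" and hR: "\<And>i. coeff h i \<in> R"
    using g h by (auto simp: b_def poly_over_def)
  define t where "t = inverse (1 - inverse a * b)"
  have a0: "a \<noteq> 0" using a(2) by auto
  have t: "t \<in> R" unfolding t_def by (rule maximal_subring_unit[OF R a max b])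
  have t1: "t * (1 - inverse a * b) = 1"
  proof -
    have "1 - inverse a * b \<noteq> 0" using a b a0 by (auto simp: field_simps)
    then show ?thesis by (simp add: t_def)
  qed
  have n0: "n > 0"
  proof (rule ccontr)
    assume "\<not> n > 0"
    then obtain c where "h = [:c:]" unfolding n_def by (auto elim: degree_eq_zeroE)
    then have "a = coeff h 0" using h by simp
    then have "a \<in> R" using hR by simp
    with a show False by simp
  qed
  \<comment> \<open>Since 1 - b/a is a unit, the relation for the inverse of x expresses x^n through lower powers.\<close>
  define q where "q = (\<Sum>i\<in>{1..n}. monom (inverse a * t * coeff g i) (n - i))"
  have q: "q \<in> poly_over R"
    by (auto simp: q_def poly_over_def coeff_sum intro!: sum_mem mult_mem a t gR)
  have dq: "degree q < n"
  proof -
    have "degree q \<le> n - 1" unfolding q_def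
      by (intro degree_sum_le) (auto intro: order.trans[OF degree_monom_le])
    with n0 show ?thesis by simp
  qed
  have "a = (\<Sum>i\<le>n. coeff g i * inverse x ^ i)"
    unfolding g(2)[symmetric] poly_altdef using le
    by (intro sum.mono_neutral_left) (auto simp: n_def coeff_eq_0)
  also have "\<dots> = b + (\<Sum>i\<in>{1..n}. coeff g i * inverse x ^ i)"
    by (simp add: atMost_atLeast0 sum.atLeast_Suc_atMost b_def)
  finally have "1 - inverse a * b = inverse a * (\<Sum>i\<in>{1..n}. coeff g i * inverse x ^ i)"
    using a0 by (auto simp: field_simps)
  then have "1 = t * (inverse a * (\<Sum>i\<in>{1..n}. coeff g i * inverse x ^ i))"
    using t1 by simp
  then have "x ^ n = x ^ n * (t * (inverse a * (\<Sum>i\<in>{1..n}. coeff g i * inverse x ^ i)))" by simp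
  also have "\<dots> = poly q x"
    unfolding q_def poly_sum poly_monom sum_distrib_left
    using x by (intro sum.cong) (auto simp: power_diff power_inverse field_simps)
  finally have xn: "x ^ n = poly q x" .
  define h' where "h' = h - monom (lead_coeff h) n + smult (lead_coeff h) q"
  have "poly h' x = a" by (simp add: h'_def poly_monom xn h)
  moreover have "h' \<in> poly_over R"
    by (auto simp: h'_def intro!: poly_over_add poly_over_diff poly_over_monom poly_over_smult h q hR)
  moreover have "degree h' < n"
  proof -
    have "degree (h - monom (lead_coeff h) n) < n"
    proof -
      have "coeff (h - monom (lead_coeff h) n) i = 0" if "i \<ge> n" for i
        using that by (auto simp: n_def coeff_eq_0)
      then have "degree (h - monom (lead_coeff h) n) \<le> n - 1"
        using n0 by (intro degree_le) auto
      then show ?thesis using n0 by simp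
    qed
    moreover have "degree (smult (lead_coeff h) q) < n" using dq degree_smult_le le_less_trans by blast
    ultimately show ?thesis unfolding h'_def by (rule degree_add_less)
  qed
  ultimately show ?thesis by (auto simp: n_def)
qed

text \<open>Zorn's lemma gives a subring maximal among those containing 1/a and avoiding
  \<open>a\<close>. If it contained neither \<open>x\<close> nor 1/x, adjoining either would produce
  \<open>a\<close>; with both representations of least degree, the descent applied to the one of
  larger degree is a contradiction.\<close>

lemma valuation_ring_avoiding:
  fixes a :: "'a::field"
  assumes "\<not> algebraic_int a"
  obtains R where "is_subring R" "a \<notin> R" "\<And>x. x \<in> R \<or> inverse x \<in> R"
proof -
  interpret Z: subring_set "\<int> :: 'a set" by unfold_locales (rule subring_Ints)
  define \<S> where "\<S> = {R. is_subring R \<and> inverse a \<in> R \<and> a \<notin> R}"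
  have "adjoin \<int> (inverse a) \<in> \<S>"
    using assms algebraic_int_if_mem_adjoin_inverse Z.adjoin_subring Z.adjoin_mem
    by (auto simp: \<S>_def)
  moreover have "\<Union>C \<in> \<S>" if C: "C \<noteq> {}" "subset.chain \<S> C" for C
  proof -
    have sub: "\<And>R. R \<in> C \<Longrightarrow> is_subring R \<and> inverse a \<in> R \<and> a \<notin> R"
      using C(2) by (auto simp: subset.chain_def \<S>_def)
    have lin: "\<And>R S. R \<in> C \<Longrightarrow> S \<in> C \<Longrightarrow> R \<subseteq> S \<or> S \<subseteq> R"
      using C(2) by (auto simp: subset_chain_def)
    have "is_subring (\<Union>C)"
      unfolding is_subring_def
    proof (intro conjI ballI)
      show "1 \<in> \<Union>C" using C(1) sub by (auto simp: is_subring_def)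
    next
      fix x y assume "x \<in> \<Union>C" "y \<in> \<Union>C"
      then obtain R S where "R \<in> C" "S \<in> C" "x \<in> R" "y \<in> S" by auto
      then obtain T where "T \<in> C" "x \<in> T" "y \<in> T" using lin by blast
      then show "x + y \<in> \<Union>C" "x * y \<in> \<Union>C" using sub[of T] by (auto simp: is_subring_def)
    next
      fix x assume "x \<in> \<Union>C"
      then show "- x \<in> \<Union>C" using sub by (auto simp: is_subring_def)
    qed
    then show ?thesis using sub C(1) by (auto simp: \<S>_def)
  qed
  ultimately obtain R where R: "R \<in> \<S>" and max: "\<And>S. S \<in> \<S> \<Longrightarrow> R \<subseteq> S \<Longrightarrow> S = R"
    using subset_Zorn_nonempty[of \<S>] by blast
  have sR: "is_subring R" and aR: "inverse a \<in> R" "a \<notin> R" using R by (auto simp: \<S>_def)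
  interpret subring_set R by unfold_locales fact
  \<comment> \<open>Containing \<open>inverse a\<close> is inherited from \<open>R\<close>, so
    \<open>R\<close> is maximal among all larger subrings avoiding \<open>a\<close>.\<close>
  have max': "S = R" if "is_subring S" "R \<subseteq> S" "a \<notin> S" for S
    using max[of S] that aR by (auto simp: \<S>_def)
  have rep: "\<exists>h\<in>poly_over R. poly h y = a" if "y \<notin> R" for y
    using max'[OF adjoin_subring[of y] adjoin_subset] adjoin_mem[of y] that
    by (auto simp: adjoin_def image_iff)
  have "x \<in> R \<or> inverse x \<in> R" for x
  proof (rule ccontr)
    assume neg: "\<not> (x \<in> R \<or> inverse x \<in> R)"
    then have x0: "x \<noteq> 0" by auto
    have least: "\<exists>h. (h \<in> poly_over R \<and> poly h y = a) \<and>
        (\<forall>h'. h' \<in> poly_over R \<and> poly h' y = a \<longrightarrow> degree h \<le> degree h')" if "y \<notin> R" for y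
      using ex_has_least_nat[of "\<lambda>h. h \<in> poly_over R \<and> poly h y = a" _ degree] rep[OF that] by blast
    obtain h where h: "h \<in> poly_over R" "poly h x = a"
      "\<And>h'. h' \<in> poly_over R \<Longrightarrow> poly h' x = a \<Longrightarrow> degree h \<le> degree h'"
      using least[of x] neg by blast
    obtain g where g: "g \<in> poly_over R" "poly g (inverse x) = a"
      "\<And>g'. g' \<in> poly_over R \<Longrightarrow> poly g' (inverse x) = a \<Longrightarrow> degree g \<le> degree g'"
      using least[of "inverse x"] neg by blast
    show False
    proof (cases "degree g \<le> degree h")
      case True
      obtain h' where "h' \<in> poly_over R" "poly h' x = a" "degree h' < degree h"
        using maximal_subring_degree_descent[OF sR aR max' h(1,2) g(1,2) True x0] by blast
      then show False using h(3)[of h'] by simp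
    next
      case False
      obtain g' where "g' \<in> poly_over R" "poly g' (inverse x) = a" "degree g' < degree g"
        using maximal_subring_degree_descent[OF sR aR max' g(1,2) h(1), of ] h(2) False x0 by auto
      then show False using g(3)[of g'] by simp
    qed
  qed
  with sR aR(2) show thesis using that by blast
qed

section \<open>Valuation rings: maximal ideal, residue characteristic, power sums\<close>

locale valuation_ring = subring_set R for R :: "'a::field set" +
  assumes valuation: "x \<in> R \<or> inverse x \<in> R"
begin

text \<open>The non-units of \<open>R\<close>; 0 is listed separately because
  \<open>inverse 0 = 0\<close> lies in \<open>R\<close>. An element outside \<open>maxideal\<close>
  is a unit of \<open>R\<close> or not in \<open>R\<close> at all.\<close>

definition maxideal :: "'a set" where
  "maxideal = {x. x = 0 \<or> inverse x \<notin> R}"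

lemma maxideal_mem: "x \<in> maxideal \<Longrightarrow> x \<in> R"
  using valuation[of x] by (auto simp: maxideal_def)

lemma one_notin_maxideal [simp]: "1 \<notin> maxideal"
  by (auto simp: maxideal_def)

lemma zero_in_maxideal [simp]: "0 \<in> maxideal"
  by (auto simp: maxideal_def)

lemma maxideal_mult: "x \<in> R \<Longrightarrow> y \<in> maxideal \<Longrightarrow> x * y \<in> maxideal"
  using mult_mem[of x "inverse (x * y)"] by (auto simp: maxideal_def field_simps)

lemma maxideal_mult': "x \<in> R \<Longrightarrow> y \<in> maxideal \<Longrightarrow> y * x \<in> maxideal"
  using maxideal_mult[of x y] by (simp add: mult.commute)

text \<open>One of x/y and y/x lies in \<open>R\<close>; in the first case x + y = (1 + x/y) y is a
  multiple of \<open>y\<close>, and the second is symmetric.\<close>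

lemma maxideal_add:
  assumes "x \<in> maxideal" "y \<in> maxideal"
  shows "x + y \<in> maxideal"
proof -
  have *: "x + y \<in> maxideal" if "y \<in> maxideal" "y \<noteq> 0" "x / y \<in> R" for x y
    using maxideal_mult[OF add_mem[OF one_mem that(3)] that(1)] that(2)
    by (simp add: distrib_right add.commute)
  consider "x = 0 \<or> y = 0" | "x \<noteq> 0" "y \<noteq> 0" "x / y \<in> R" | "x \<noteq> 0" "y \<noteq> 0" "y / x \<in> R"
    using valuation[of "x / y"] by auto
  then show ?thesis
    using assms *[of x y] *[of y x] by cases (auto simp: add.commute)
qed

lemma maxideal_uminus: "x \<in> maxideal \<Longrightarrow> - x \<in> maxideal"
  using maxideal_mult[OF uminus_mem[OF one_mem], of x] by simp

lemma maxideal_sum: "(\<And>i. i \<in> I \<Longrightarrow> f i \<in> maxideal) \<Longrightarrow> sum f I \<in> maxideal"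
  by (induction I rule: infinite_finite_induct) (auto intro: maxideal_add)

lemma inverse_mem: "x \<notin> maxideal \<Longrightarrow> inverse x \<in> R"
  by (auto simp: maxideal_def)

lemma unit_mult: "x \<notin> maxideal \<Longrightarrow> y \<notin> maxideal \<Longrightarrow> x * y \<notin> maxideal"
  by (auto simp: maxideal_def intro: mult_mem)

lemma unit_power: "x \<notin> maxideal \<Longrightarrow> x ^ n \<notin> maxideal"
  by (induction n) (auto dest: unit_mult)

lemma unit_prod: "(\<And>i. i \<in> I \<Longrightarrow> f i \<notin> maxideal) \<Longrightarrow> prod f I \<notin> maxideal"
  by (induction I rule: infinite_finite_induct) (simp_all add: unit_mult)

lemma unit_diff: "x \<notin> maxideal \<Longrightarrow> y \<in> maxideal \<Longrightarrow> x - y \<notin> maxideal"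
  using maxideal_add[of "x - y" y] by auto

text \<open>Divisibility over \<open>R\<close> is a total preorder on nonzero elements, so a finite
  set has an element that divides all others: one of largest absolute value.\<close>

lemma exists_dominating:
  assumes "finite S" "S \<noteq> {}" "0 \<notin> S"
  shows "\<exists>a\<in>S. \<forall>z\<in>S. z / a \<in> R"
  using assms
proof (induction rule: finite_ne_induct)
  case (insert x F)
  then obtain a where a: "a \<in> F" "\<forall>z\<in>F. z / a \<in> R" by auto
  show ?case
  proof (cases "x / a \<in> R")
    case True
    with a show ?thesis by auto
  next
    case False
    then have "a / x \<in> R" using valuation[of "x / a"] by simp
    moreover have "z / x = (z / a) * (a / x)" for z
      using insert a by (auto simp: field_simps)
    ultimately have "\<forall>z\<in>F. z / x \<in> R" using a by (metis mult_mem)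
    then show ?thesis using insert by (intro bexI[of _ x]) auto
  qed
qed auto

text \<open>The integers in \<open>maxideal\<close> form an ideal, and \<open>p\<close> is its least
  positive element, the residue characteristic. It is at least 2 because 1 is a unit.\<close>

lemma int_generator_dvd:
  assumes "of_int B \<in> maxideal" "B \<noteq> 0"
  obtains p :: int where "p \<ge> 2" "of_int p \<in> maxideal"
    "\<And>x. of_int x \<in> maxideal \<Longrightarrow> p dvd x"
proof -
  define P where "P n \<longleftrightarrow> n > 0 \<and> of_int (int n) \<in> maxideal" for n :: nat
  have "of_int \<bar>B\<bar> \<in> maxideal" using assms maxideal_uminus by (auto simp: abs_if)
  then have ex: "P (nat \<bar>B\<bar>)" using assms by (auto simp: P_def)
  define p where "p = int (LEAST n. P n)"
  have p: "p > 0" "of_int p \<in> maxideal" using LeastI[of P, OF ex] by (auto simp: P_def p_def)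
  then have "p \<noteq> 1" by auto
  then have "p \<ge> 2" using p by simp
  moreover have "p dvd x" if "of_int x \<in> maxideal" for x
  proof (rule ccontr)
    assume "\<not> p dvd x"
    then have pos: "x mod p > 0" using p by (simp add: dvd_eq_mod_eq_0 order_less_le)
    have "(of_int (x mod p) :: 'a) = of_int x + of_int p * (- of_int (x div p))"
      by (metis add.commute add_diff_cancel_left' diff_conv_add_uminus mult_minus_right mod_mult_div_eq of_int_add of_int_mult)
    moreover have "of_int x + of_int p * (- of_int (x div p)) \<in> maxideal"
      using that p by (intro maxideal_add maxideal_mult' uminus_mem of_int_mem)
    ultimately have "of_int (x mod p) \<in> maxideal" by simp
    then have "P (nat (x mod p))" using pos by (auto simp: P_def)
    then have "(LEAST n. P n) \<le> nat (x mod p)" by (rule Least_le)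
    then have "p \<le> x mod p" using pos by (simp add: p_def)
    moreover have "x mod p < p" using p(1) by (rule pos_mod_bound)
    ultimately show False by simp
  qed
  ultimately show thesis using p that by blast
qed

text \<open>Translates valuations back into divisibility of integers: factors \<open>p\<close> are
  split off one at a time, and the last one comes from \<open>y \<in> maxideal\<close>.\<close>

lemma power_dvd_if_mem_power_maxideal:
  assumes p: "\<And>x. of_int x \<in> maxideal \<Longrightarrow> p dvd x" "of_int p \<in> maxideal" "(of_int p :: 'a) \<noteq> 0"
    and "of_int n = of_int p ^ v * y" "y \<in> maxideal"
  shows "p ^ Suc v dvd n"
  using assms(4)
proof (induction v arbitrary: n)
  case 0
  then show ?case using p assms(5) by auto
next
  case (Suc v)
  have "of_int n = of_int p * (of_int p ^ v * y)" using Suc.prems by simp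
  also have "\<dots> \<in> maxideal"
    using p(2) assms(5) maxideal_mem by (intro maxideal_mult' mult_mem power_mem of_int_mem) auto
  finally obtain n' where n': "n = p * n'" using p(1) by (auto elim: dvdE)
  then have "of_int n' = of_int p ^ v * y" using Suc.prems p(3) by simp
  then have "p ^ Suc v dvd n'" by (rule Suc.IH)
  then show ?case using n' by (auto intro: mult_dvd_mono)
qed

text \<open>Lagrange interpolation would divide by differences of the points, which may be
  non-units; this construction inverts only the values of \<open>E\<close>.\<close>

lemma unit_indicator_poly:
  assumes "finite V" and E: "E \<in> poly_over R" and "\<And>z. z \<in> V \<Longrightarrow> poly E (u z) \<notin> maxideal"
  obtains h where "h \<in> poly_over R" "\<And>z. z \<in> V \<Longrightarrow> poly (E * h) (u z) = 1"
proof -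
  \<comment> \<open>The witness is the quotient of \<open>1 - \<Prod>(1 - E / E(u z))\<close> by \<open>E\<close>.\<close>
  have "\<exists>h\<in>poly_over R. 1 - (\<Prod>z\<in>V. 1 - smult (inverse (poly E (u z))) E) = E * h"
    using assms(1,3)
  proof (induction rule: finite_induct)
    case empty
    then show ?case by (intro bexI[of _ 0] poly_over_0) auto
  next
    case (insert x F)
    then obtain h where h: "h \<in> poly_over R"
        "1 - (\<Prod>z\<in>F. 1 - smult (inverse (poly E (u z))) E) = E * h" by auto
    define i where "i = inverse (poly E (u x))"
    have i: "i \<in> R" using insert by (auto simp: i_def intro: inverse_mem)
    have "1 - (1 - smult i E) * (1 - E * h) = E * (h + smult i (1 - E * h))"
      by (simp add: algebra_simps smult_diff_right)
    moreover have "(\<Prod>z\<in>F. 1 - smult (inverse (poly E (u z))) E) = 1 - E * h"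
      using h(2) by (simp add: algebra_simps)
    ultimately have "1 - (\<Prod>z\<in>insert x F. 1 - smult (inverse (poly E (u z))) E)
        = E * (h + smult i (1 - E * h))"
      using insert.hyps by (simp add: i_def[symmetric])
    moreover have "h + smult i (1 - E * h) \<in> poly_over R"
      by (intro poly_over_add poly_over_smult poly_over_diff poly_over_mult poly_over_1 h E i)
    ultimately show ?case by blast
  qed
  then obtain h where h: "h \<in> poly_over R"
      "1 - (\<Prod>z\<in>V. 1 - smult (inverse (poly E (u z))) E) = E * h" by blast
  have "poly (E * h) (u z) = 1" if "z \<in> V" for z
  proof -
    have "poly E (u z) \<noteq> 0" using assms(3)[OF that] by auto
    then have "(\<Prod>w\<in>V. poly (1 - smult (inverse (poly E (u w))) E) (u z)) = 0"
      using that assms(1) by (auto simp: prod_zero_iff intro!: bexI[of _ z])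
    then show ?thesis unfolding h(2)[symmetric] by (simp add: poly_prod)
  qed
  with h show thesis using that by blast
qed

text \<open>The recurrence for power sums spreads divisibility by \<open>\<pi>\<close> from the
  window to all later exponents, hence to the sums of \<open>u z ^ J * poly h (u z)\<close>. A
  choice of polynomial turns these summands into the indicator of the units.\<close>

lemma power_sum_window_unit_count:
  fixes u :: "'b \<Rightarrow> 'a"
  assumes S: "finite S" and u: "\<And>z. z \<in> S \<Longrightarrow> u z \<in> R"
    and window: "\<And>j. J \<le> j \<Longrightarrow> j < J + card S \<Longrightarrow> \<exists>y\<in>R. N * (\<Sum>z\<in>S. u z ^ j) = \<pi> * y"
  shows "\<exists>y\<in>R. N * of_nat (card {z\<in>S. u z \<notin> maxideal}) = \<pi> * y"
proof -
  define k where "k = card S"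
  \<comment> \<open>\<open>M\<close> is the \<open>R\<close>-module of multiples of
    \<open>\<pi>\<close>; the closure properties below let divisibility pass through linear
    combinations.\<close>
  define M where "M = {x. \<exists>y\<in>R. x = \<pi> * y}"
  define q where "q j = (\<Sum>z\<in>S. u z ^ j)" for j
  have M_mult: "x * y \<in> M" if "x \<in> R" "y \<in> M" for x y
  proof -
    from that(2) obtain y' where "y' \<in> R" "y = \<pi> * y'" unfolding M_def by blast
    then show ?thesis unfolding M_def using that
      by (auto intro!: bexI[of _ "x * y'"] mult_mem)
  qed
  have M_add: "x + y \<in> M" if "x \<in> M" "y \<in> M" for x y
  proof -
    from that obtain x' y' where "x' \<in> R" "x = \<pi> * x'" "y' \<in> R" "y = \<pi> * y'"
      unfolding M_def by blast
    then show ?thesis unfolding M_def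
      by (auto intro!: bexI[of _ "x' + y'"] add_mem simp: algebra_simps)
  qed
  have M_0: "0 \<in> M" by (auto simp: M_def intro: bexI[of _ 0])
  have M_sum: "sum f I \<in> M" if "\<And>i. i \<in> I \<Longrightarrow> f i \<in> M" for f :: "nat \<Rightarrow> 'a" and I
    using that by (induction I rule: infinite_finite_induct) (auto intro: M_0 M_add)
  define A where "A = (\<Prod>z\<in>S. [:- u z, 1:])"
  have A: "A \<in> poly_over R"
    unfolding A_def using u
    by (intro poly_over_prod poly_over_pCons poly_over_0) (auto intro: uminus_mem)
  have degA: "degree A = k" unfolding A_def k_def by (subst degree_prod_eq_sum_degree) auto
  have leadA: "coeff A k = 1"
    using lead_coeff_prod[of "\<lambda>z. [:- u z, 1:]" S] by (simp add: degA[symmetric] A_def)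
  \<comment> \<open>Each \<open>u z\<close> is a root of the monic polynomial \<open>A\<close>;
    multiply by \<open>u z ^ j\<close> and sum over \<open>S\<close>.\<close>
  have rec: "(\<Sum>l\<le>k. coeff A l * q (j + l)) = 0" for j
  proof -
    have "(\<Sum>l\<le>k. coeff A l * q (j + l)) = (\<Sum>z\<in>S. \<Sum>l\<le>k. coeff A l * u z ^ (j + l))"
      unfolding q_def sum_distrib_left by (rule sum.swap)
    also have "\<dots> = (\<Sum>z\<in>S. u z ^ j * poly A (u z))"
      unfolding poly_altdef degA sum_distrib_left
      by (intro sum.cong) (auto simp: power_add algebra_simps)
    also have "\<dots> = 0" using S by (intro sum.neutral) (auto simp: A_def poly_prod prod_zero_iff)
    finally show ?thesis .
  qed
  have qM: "N * q j \<in> M" if "j \<ge> J" for j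
    using that
  proof (induction j rule: less_induct)
    case (less j)
    show ?case
    proof (cases "j < J + k")
      case True
      then show ?thesis using window[of j] less.prems by (auto simp: M_def q_def k_def)
    next
      case False
      define i where "i = j - k"
      have j: "j = i + k" "J \<le> i" using False by (auto simp: i_def)
      have "q j = (-1) * (\<Sum>l<k. coeff A l * q (i + l))"
        using rec[of i] leadA by (simp add: lessThan_Suc_atMost[symmetric] j add_eq_0_iff2)
      then have "N * q j = (-1) * (\<Sum>l<k. coeff A l * (N * q (i + l)))"
        by (simp add: sum_distrib_left algebra_simps)
      also have "\<dots> \<in> M"
        using A j by (intro M_mult uminus_mem one_mem M_sum less.IH) (auto simp: poly_over_def)
      finally show ?thesis .
    qed
  qed
  have evalM: "N * (\<Sum>z\<in>S. u z ^ J * poly h (u z)) \<in> M" if "h \<in> poly_over R" for h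
  proof -
    have "(\<Sum>l\<le>degree h. coeff h l * (N * q (J + l))) = N * (\<Sum>l\<le>degree h. \<Sum>z\<in>S. coeff h l * u z ^ (J + l))"
      by (simp add: q_def sum_distrib_left algebra_simps)
    also have "\<dots> = N * (\<Sum>z\<in>S. u z ^ J * poly h (u z))"
      unfolding poly_altdef sum_distrib_left
      by (subst sum.swap) (auto simp: power_add algebra_simps intro!: sum.cong)
    finally have "N * (\<Sum>z\<in>S. u z ^ J * poly h (u z)) = (\<Sum>l\<le>degree h. coeff h l * (N * q (J + l)))" ..
    also have "\<dots> \<in> M"
      using that by (intro M_sum M_mult[OF _ qM]) (auto simp: poly_over_def)
    finally show ?thesis .
  qed
  define V where "V = {z\<in>S. u z \<notin> maxideal}"
  \<comment> \<open>\<open>C\<close> kills the non-units, and the factor of degree \<open>J\<close>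
    in \<open>E\<close> accounts for the weight \<open>u z ^ J\<close>. At a unit, \<open>E\<close>
    has a unit value, since a unit minus a non-unit is a unit.\<close>
  define C where "C = (\<Prod>z\<in>S - V. [:- u z, 1:])"
  define E where "E = monom 1 J * C"
  have C: "C \<in> poly_over R"
    unfolding C_def using u
    by (intro poly_over_prod poly_over_pCons poly_over_0) (auto intro: uminus_mem)
  have E: "E \<in> poly_over R" unfolding E_def by (intro poly_over_mult poly_over_monom C one_mem)
  have "poly E (u z) \<notin> maxideal" if "z \<in> V" for z
  proof -
    have "poly E (u z) = u z ^ J * (\<Prod>w\<in>S - V. u z - u w)"
      by (simp add: E_def C_def poly_monom poly_prod)
    moreover have "u z - u w \<notin> maxideal" if "w \<in> S - V" for w
      using that \<open>z \<in> V\<close> by (intro unit_diff) (auto simp: V_def)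
    moreover have "u z \<notin> maxideal" using \<open>z \<in> V\<close> by (simp add: V_def)
    ultimately show ?thesis by (metis unit_mult unit_power unit_prod)
  qed
  then obtain h where h: "h \<in> poly_over R" "\<And>z. z \<in> V \<Longrightarrow> poly (E * h) (u z) = 1"
    using unit_indicator_poly[of V E u] E S by (auto simp: V_def)
  have "u z ^ J * poly (C * h) (u z) = (if z \<in> V then 1 else 0)" if "z \<in> S" for z
  proof (cases "z \<in> V")
    case True
    then show ?thesis using h(2)[of z] by (simp add: E_def poly_monom algebra_simps)
  next
    case False
    then have "poly C (u z) = 0" using that S by (auto simp: C_def poly_prod prod_zero_iff)
    then show ?thesis using False by simp
  qed
  then have "(\<Sum>z\<in>S. u z ^ J * poly (C * h) (u z)) = (\<Sum>z\<in>S. if z \<in> V then 1 else 0)"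
    by (intro sum.cong) auto
  also have "\<dots> = of_nat (card V)"
    using S by (simp add: sum.If_cases V_def Collect_conj_eq Int_commute)
  finally have "N * of_nat (card V) \<in> M"
    using evalM[OF poly_over_mult[OF C h(1)]] by simp
  then show ?thesis by (simp add: M_def V_def)
qed

end

section \<open>Integrality from a window of integral power sums\<close>

lemma algebraic_int_if_power_sum_window:
  fixes S :: "complex set" and N :: int
  assumes S: "finite S" and f: "(\<Prod>z\<in>S. [:- z, 1:]) \<in> poly_over \<rat>"
    and window: "\<And>j. card S * v < j \<Longrightarrow> j \<le> card S * v + card S \<Longrightarrow> of_int N * (\<Sum>z\<in>S. z ^ j) \<in> \<int>"
    and N: "N \<noteq> 0" "\<bar>N\<bar> * int (card S) < 2 ^ Suc v" and z0: "z0 \<in> S"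
  shows "algebraic_int z0"
proof (rule ccontr)
  assume "\<not> algebraic_int z0"
  then obtain R where "is_subring R" "z0 \<notin> R" and val: "\<And>x. x \<in> R \<or> inverse x \<in> R"
    using valuation_ring_avoiding by blast
  interpret valuation_ring R by unfold_locales fact+
  have z00: "z0 \<noteq> 0" using \<open>z0 \<notin> R\<close> by auto
  \<comment> \<open>Zero is removed because \<open>S\<close> may contain it and the dominating
    element has to be invertible.\<close>
  obtain a where a: "a \<in> S" "a \<noteq> 0" and dom: "\<forall>z\<in>S - {0}. z / a \<in> R"
    using exists_dominating[of "S - {0}"] S z0 z00 by auto
  define k where "k = card S"
  define c where "c = inverse a"
  define u where "u z = z * c" for z
  have uR: "u z \<in> R" if "z \<in> S" for z
    using dom that by (cases "z = 0") (auto simp: u_def c_def divide_inverse)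
  have "a \<notin> R"
  proof
    assume "a \<in> R"
    then have "u z0 * a \<in> R" using uR z0 by (intro mult_mem)
    then show False using \<open>z0 \<notin> R\<close> a by (simp add: u_def c_def mult.assoc)
  qed
  then have c: "c \<in> maxideal" "c \<noteq> 0" using a by (auto simp: c_def maxideal_def)
  note cR = maxideal_mem[OF c(1)]
  define f where "f = (\<Prod>z\<in>S. [:- z, 1:])"
  define A where "A = (\<Prod>z\<in>S. [:- u z, 1:])"
  have A: "A \<in> poly_over R"
    unfolding A_def using uR
    by (intro poly_over_prod poly_over_pCons poly_over_0) (auto intro: uminus_mem)
  have degA: "degree A = k" unfolding A_def k_def by (subst degree_prod_eq_sum_degree) auto
  have leadA: "coeff A k = 1"
    using lead_coeff_prod[of "\<lambda>z. [:- u z, 1:]" S] by (simp add: degA[symmetric] A_def)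
  \<comment> \<open>Compares coefficients in f(aX) = a^k A(X).\<close>
  have coeffA: "a ^ l * coeff f l = a ^ k * coeff A l" for l
  proof -
    have "pcompose f (monom a 1) = (\<Prod>z\<in>S. smult a [:- u z, 1:])"
      unfolding f_def pcompose_prod using a
      by (intro prod.cong) (auto simp: pcompose_pCons monom_altdef u_def c_def)
    also have "\<dots> = smult (a ^ k) A"
      unfolding A_def k_def prod_smult by simp
    finally have "coeff (pcompose f (monom a 1)) l = coeff (smult (a ^ k) A) l" by simp
    then show ?thesis by (simp del: coeff_pcompose_monom_linear add: coeff_pcompose_monom_linear[of f a l])
  qed
  \<comment> \<open>Since \<open>u a = 1\<close> is a root of the monic \<open>A\<close>, its lower
    coefficients sum to -1, so they cannot all be non-units.\<close>
  obtain l where l: "l < k" "coeff A l \<notin> maxideal"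
  proof (rule ccontr)
    assume "\<not> thesis"
    then have "(\<Sum>l<k. coeff A l) \<in> maxideal" using that by (intro maxideal_sum) auto
    moreover have "poly A 1 = 0"
      using a S by (auto simp: A_def poly_prod prod_zero_iff u_def c_def intro!: bexI[of _ a])
    then have "1 = - (\<Sum>l<k. coeff A l)"
      by (simp add: poly_altdef degA lessThan_Suc_atMost[symmetric] leadA add_eq_0_iff2)
    ultimately have "1 \<in> maxideal" using maxideal_uminus by metis
    then show False by simp
  qed
  \<comment> \<open>So \<open>a\<close> to the power \<open>k - l\<close> is a rational number up to a unit.\<close>
  define w where "w = coeff A l"
  define e where "e = inverse (coeff f l)"
  have w0: "w \<noteq> 0" using l by (auto simp: w_def)
  have wR: "w \<in> R" using A by (auto simp: w_def poly_over_def)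
  have cf: "coeff f l = a ^ (k - l) * w"
    using coeffA[of l] a l(1) by (simp add: w_def power_diff field_simps)
  have ew: "c ^ (k - l) = e * w"
    using a w0 by (simp add: e_def cf c_def field_simps)
  have "e = c ^ (k - l) * inverse w" using ew w0 by simp
  moreover have "c ^ (k - l) \<in> maxideal"
  proof -
    obtain i where "k - l = Suc i" using l(1) by (metis Suc_diff_Suc)
    then show ?thesis using c(1) cR by (auto intro: maxideal_mult' power_mem)
  qed
  ultimately have e: "e \<in> maxideal"
    using inverse_mem[OF l(2)] by (auto simp: w_def intro: maxideal_mult')
  have e0: "e \<noteq> 0" using a w0 by (simp add: e_def cf)
  \<comment> \<open>Here the rationality of the coefficients of \<open>f\<close> enters. A rational
    non-unit has its numerator in \<open>maxideal\<close>, which yields the residue characteristic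
    \<open>p\<close>; the coprime denominator is then a unit, and \<open>e\<close> is
    \<open>p\<close> times an element of \<open>R\<close>.\<close>
  have "e \<in> \<rat>" using f by (auto simp: e_def f_def poly_over_def)
  then obtain r where r: "e = of_rat r" by (auto elim: Rats_cases)
  obtain B D where BD: "quotient_of r = (B, D)" by force
  then have D: "D > 0" "coprime B D" "r = of_int B / of_int D"
    by (auto simp: quotient_of_denom_pos quotient_of_coprime quotient_of_div)
  then have eBD: "of_int B = e * of_int D" by (simp add: r of_rat_divide)
  have Bm: "of_int B \<in> maxideal" unfolding eBD using e of_int_mem by (intro maxideal_mult')
  have B0: "B \<noteq> 0" using eBD e0 D by auto
  have Dm: "of_int D \<notin> maxideal"
  proof
    assume Dm: "of_int D \<in> maxideal"
    obtain x y where "x * B + y * D = 1"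
      using D(2) by (metis bezout_int coprime_imp_gcd_eq_1)
    then have "of_int x * of_int B + of_int y * of_int D = (1 :: complex)"
      by (metis of_int_1 of_int_add of_int_mult)
    then show False
      using maxideal_add[OF maxideal_mult maxideal_mult, OF of_int_mem Bm of_int_mem Dm]
      by (metis one_notin_maxideal)
  qed
  obtain p where p: "p \<ge> 2" "of_int p \<in> maxideal" "\<And>x. of_int x \<in> maxideal \<Longrightarrow> p dvd x"
    using int_generator_dvd[OF Bm B0] by blast
  obtain B' where B': "B = p * B'" using p(3)[OF Bm] by (auto elim: dvdE)
  have ep: "e = of_int p * (of_int B' * inverse (of_int D))"
    using eBD D(1) by (simp add: B' field_simps)
  \<comment> \<open>The power \<open>c ^ (k * v)\<close> contains \<open>(c ^ (k - l)) ^ v\<close>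
    and hence \<open>p ^ v\<close>. The one extra factor \<open>c\<close> lies in
    \<open>maxideal\<close> and raises the divisibility to \<open>p ^ Suc v\<close>.\<close>
  define J where "J = Suc (k * v)"
  define V where "V = {z\<in>S. u z \<notin> maxideal}"
  have "\<exists>y\<in>R. of_int N * of_nat (card {z\<in>S. u z \<notin> maxideal}) = c ^ J * y"
  proof (rule power_sum_window_unit_count[OF S uR])
    fix j assume j: "J \<le> j" "j < J + card S"
    have "of_int N * (\<Sum>z\<in>S. u z ^ j) = c ^ j * (of_int N * (\<Sum>z\<in>S. z ^ j))"
      by (simp add: u_def power_mult_distrib sum_distrib_left algebra_simps)
    also have "\<dots> = c ^ J * (c ^ (j - J) * (of_int N * (\<Sum>z\<in>S. z ^ j)))"
      using j by (simp add: power_add[symmetric] flip: mult.assoc)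
    finally have eq: "of_int N * (\<Sum>z\<in>S. u z ^ j) =
        c ^ J * (c ^ (j - J) * (of_int N * (\<Sum>z\<in>S. z ^ j)))" .
    have "of_int N * (\<Sum>z\<in>S. z ^ j) \<in> R"
      using window[of j] j Ints_subset by (auto simp: J_def k_def)
    then show "\<exists>y\<in>R. of_int N * (\<Sum>z\<in>S. u z ^ j) = c ^ J * y"
      using cR eq by (blast intro: mult_mem power_mem)
  qed
  then obtain y where y: "y \<in> R" "of_int N * of_nat (card V) = c ^ J * y" by (auto simp: V_def)
  have "c ^ (k * v) = (c ^ (k - l)) ^ v * c ^ (l * v)"
    using l(1) by (simp add: power_add[symmetric] power_mult[symmetric] diff_mult_distrib)
  then have "c ^ J * y = of_int p ^ v * ((of_int B' * inverse (of_int D) * w) ^ v * c ^ (l * v) * y * c)"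
    by (simp add: J_def ew ep power_mult_distrib algebra_simps)
  then have "of_int (N * int (card V)) =
      of_int p ^ v * ((of_int B' * inverse (of_int D) * w) ^ v * c ^ (l * v) * y * c)"
    using y(2) by simp
  moreover have "(of_int B' * inverse (of_int D) * w) ^ v * c ^ (l * v) * y * c \<in> maxideal"
    using c(1) cR y(1) wR inverse_mem[OF Dm] of_int_mem
    by (intro maxideal_mult mult_mem power_mem) auto
  ultimately have "p ^ Suc v dvd N * int (card V)"
    using p by (intro power_dvd_if_mem_power_maxideal) auto
  \<comment> \<open>The element \<open>a\<close> itself is counted, because
    \<open>u a = 1\<close>.\<close>
  moreover have "card V > 0"
    using a S by (auto simp: V_def card_gt_0_iff u_def c_def)
  ultimately have "p ^ Suc v \<le> \<bar>N * int (card V)\<bar>"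
    using N(1) by (intro zdvd_imp_le) (auto simp: dvd_abs_iff)
  also have "\<dots> \<le> \<bar>N\<bar> * int (card S)"
    using S by (auto simp: abs_mult V_def intro!: mult_left_mono card_mono)
  also have "\<dots> < 2 ^ Suc v" by fact
  also have "\<dots> \<le> p ^ Suc v" using p(1) by (intro power_mono) auto
  finally show False by simp
qed

subsection \<open>Subfields of the complex numbers\<close>

text \<open>The same scalar action as in \<open>field_degree\<close>, so that
  \<open>field_degree\<close> unfolds to \<open>rat_vs.dim\<close>.\<close>

interpretation rat_vs: vector_space "\<lambda>(r::rat) (x::complex). of_rat r * x"
  by unfold_locales (auto simp: algebra_simps of_rat_add of_rat_mult)

text \<open>Stated by a finite spanning set because \<open>dim\<close> is also 0 for spaces with an
  infinite basis; the spanning set may leave \<open>V\<close>.\<close>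

definition finite_dimensional :: "complex set \<Rightarrow> bool" where
  "finite_dimensional V \<longleftrightarrow> (\<exists>B. finite B \<and> V \<subseteq> rat_vs.span B)"

lemma subfield_imp_subring: "is_subfield F \<Longrightarrow> is_subring F"
  by (auto simp: is_subfield_def is_subring_def)

lemma Rats_subset_subfield:
  assumes "is_subfield F"
  shows "\<rat> \<subseteq> F"
proof
  interpret subring_set F using assms by unfold_locales (rule subfield_imp_subring)
  fix x :: complex assume "x \<in> \<rat>"
  then obtain a b where "x = of_int a / of_int b" by (auto elim: Rats_cases')
  then show "x \<in> F"
    using assms of_int_mem mult_mem by (auto simp: is_subfield_def divide_inverse)
qed

lemma subfield_Rats: "is_subfield \<rat>"
  by (auto simp: is_subfield_def)

lemma subfield_field_generated: "is_subfield (field_generated S)"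
  by (auto simp: field_generated_def is_subfield_def)

lemma field_generated_superset: "S \<subseteq> field_generated S"
  by (auto simp: field_generated_def)

lemma field_generated_least: "is_subfield F \<Longrightarrow> S \<subseteq> F \<Longrightarrow> field_generated S \<subseteq> F"
  by (auto simp: field_generated_def)

subsection \<open>Finite-dimensional extensions of the rationals\<close>

lemma finite_dimensional_Rats: "finite_dimensional \<rat>"
proof -
  have "(\<rat> :: complex set) \<subseteq> rat_vs.span {1}"
    using rat_vs.span_scale[OF rat_vs.span_base[of 1 "{1}"]] by (auto elim!: Rats_cases)
  then show ?thesis unfolding finite_dimensional_def by blast
qed

text \<open>Among the powers of \<open>y\<close> up to the size of a spanning set there is a
  rational linear relation, which is a polynomial equation for \<open>y\<close>.\<close>

lemma algebraic_if_finite_dimensional: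
  assumes R: "is_subring R" "finite_dimensional R" and y: "y \<in> R"
  shows "algebraic y"
proof -
  interpret subring_set R by unfold_locales fact
  obtain B where B: "finite B" "R \<subseteq> rat_vs.span B" using R by (auto simp: finite_dimensional_def)
  define n where "n = card B"
  show ?thesis
  \<comment> \<open>Linear dependence speaks of the set of powers; if two powers coincide, the
    difference of the two monomials serves as the polynomial instead.\<close>
  proof (cases "inj_on (\<lambda>i. y ^ i) {..n}")
    case inj: True
    define P where "P = (\<lambda>i. y ^ i) ` {..n}"
    have "card P = Suc n" "finite P" using inj by (auto simp: P_def card_image)
    moreover have "P \<subseteq> rat_vs.span B" using B y by (auto simp: P_def intro: power_mem)
    ultimately have "rat_vs.dependent P"
      using rat_vs.independent_span_bound[OF B(1), of P] by (auto simp: n_def)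
    then obtain c v where cv: "v \<in> P" "c v \<noteq> 0" "(\<Sum>v\<in>P. of_rat (c v) * v) = 0"
      using rat_vs.dependent_finite[OF \<open>finite P\<close>] by auto
    define p where "p = (\<Sum>i\<le>n. monom (of_rat (c (y ^ i)) :: complex) i)"
    have coeff_p: "coeff p i = (if i \<le> n then of_rat (c (y ^ i)) else 0)" for i
      by (simp add: p_def coeff_sum)
    obtain i where "i \<le> n" "v = y ^ i" using cv by (auto simp: P_def)
    then have "coeff p i \<noteq> 0" using cv by (simp add: coeff_p)
    then have "p \<noteq> 0" by auto
    moreover have "poly p y = 0"
      using cv(3) inj by (simp add: P_def sum.reindex p_def poly_sum poly_monom)
    ultimately show ?thesis by (intro algebraicI'[of p]) (auto simp: coeff_p)
  next
    case False
    then obtain i j where ij: "i \<noteq> j" "y ^ i = y ^ j" by (auto simp: inj_on_def)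
    define p where "p = (monom 1 i - monom 1 j :: complex poly)"
    have "coeff p i \<noteq> 0" using ij by (simp add: p_def)
    then have "p \<noteq> 0" by auto
    then show ?thesis using ij by (intro algebraicI'[of p]) (auto simp: p_def poly_monom)
  qed
qed

text \<open>A nonzero \<open>y\<close> satisfies c + y q(y) = 0 with a nonzero integer
  \<open>c\<close>, so its inverse is -q(y)/c.\<close>

lemma subfield_if_finite_dimensional:
  assumes R: "is_subring R" "\<rat> \<subseteq> R" "finite_dimensional R"
  shows "is_subfield R"
proof -
  interpret subring_set R by unfold_locales fact
  have "inverse y \<in> R" if "y \<in> R" for y
  proof (cases "y = 0")
    case False
    have "algebraic y" using algebraic_if_finite_dimensional[OF R(1,3) that] .
    then obtain p where p: "poly (map_poly of_int p) y = 0" "coeff p 0 \<noteq> 0"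
      using algebraicE'_nonzero[OF _ False] by blast
    obtain c q where q: "p = pCons c q" by (cases p)
    have "poly (map_poly of_int q) y \<in> R"
      using that by (intro poly_mem) (auto simp: poly_over_def coeff_map_poly of_int_mem)
    moreover have "inverse (of_int c) \<in> R" using R(2) by auto
    moreover have "inverse y = - (poly (map_poly of_int q) y * inverse (of_int c))"
    proof -
      have "of_int c + y * poly (map_poly of_int q) y = 0"
        using p(1) by (simp add: q map_poly_pCons)
      then show ?thesis using p(2) False by (simp add: q field_simps add_eq_0_iff)
    qed
    ultimately show ?thesis by (auto intro: uminus_mem mult_mem)
  qed auto
  then show ?thesis
    unfolding is_subfield_def by (auto intro: add_mem mult_mem uminus_mem)
qed

text \<open>The products \<open>b * a ^ i\<close> with \<open>i < n\<close> suffice: their span is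
  closed under multiplication by \<open>a\<close>, since a rational equation of degree
  \<open>n\<close> rewrites \<open>a ^ n\<close>.\<close>

lemma finite_dimensional_adjoin:
  assumes F: "is_subring F" "finite_dimensional F" and a: "algebraic a"
  shows "finite_dimensional (adjoin F a)"
proof -
  obtain B where B: "finite B" "F \<subseteq> rat_vs.span B" using F by (auto simp: finite_dimensional_def)
  obtain g where g: "g \<noteq> 0" "\<And>i. coeff g i \<in> \<rat>" "poly g a = 0"
    using a by (auto simp: algebraic_altdef)
  define n where "n = degree g"
  have n0: "n > 0"
  proof (rule ccontr)
    assume "\<not> n > 0"
    then obtain c where "g = [:c:]" unfolding n_def by (auto elim: degree_eq_zeroE)
    then show False using g by auto
  qed
  define B' where "B' = (\<lambda>(b, i). b * a ^ i) ` (B \<times> {..<n})"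
  define T where "T = rat_vs.span B'"
  have T: "rat_vs.subspace T" unfolding T_def by (rule rat_vs.subspace_span)
  note T_scale = rat_vs.subspace_scale[OF T] and T_add = rat_vs.subspace_add[OF T]
    and T_0 = rat_vs.subspace_0[OF T] and T_sum = rat_vs.subspace_sum[OF T]
  have base: "b * a ^ i \<in> T" if "b \<in> B" "i < n" for b i
    unfolding T_def using that by (intro rat_vs.span_base) (auto simp: B'_def)
  have FT: "x \<in> T" if "x \<in> F" for x
  proof -
    have "rat_vs.span B \<subseteq> T"
      using base[of _ 0] n0 T by (intro rat_vs.span_minimal) auto
    then show ?thesis using that B by auto
  qed
  have step: "a * t \<in> T" if "t \<in> T" for t
  proof -
    have "rat_vs.span B' \<subseteq> {t. a * t \<in> T}"
    proof (rule rat_vs.span_minimal)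
      show "B' \<subseteq> {t. a * t \<in> T}"
      proof
        fix t assume "t \<in> B'"
        then obtain b i where bi: "b \<in> B" "i < n" "t = b * a ^ i" by (auto simp: B'_def)
        show "t \<in> {t. a * t \<in> T}"
        proof (cases "Suc i < n")
          case True
          then show ?thesis using base[of b "Suc i"] bi by (simp add: algebra_simps)
        next
          case False
          then have i: "Suc i = n" using bi by simp
          have "coeff g n * a ^ n + (\<Sum>l<n. coeff g l * a ^ l) = 0"
            using g(3) by (simp add: poly_altdef n_def[symmetric] lessThan_Suc_atMost[symmetric] add.commute)
          moreover have gn: "coeff g n \<noteq> 0" using g(1) by (simp add: n_def)
          ultimately have an: "a ^ n = (\<Sum>l<n. (- coeff g l / coeff g n) * a ^ l)"
            by (simp add: sum_divide_distrib[symmetric] sum_negf field_simps add_eq_0_iff)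
          have "a * t = b * a ^ n" unfolding i[symmetric] bi(3) by simp
          also have "\<dots> = (\<Sum>l<n. (- coeff g l / coeff g n) * (b * a ^ l))"
            unfolding an sum_distrib_left by (intro sum.cong) auto
          also have "\<dots> \<in> T"
          proof (rule T_sum)
            fix l assume "l \<in> {..<n}"
            then have "b * a ^ l \<in> T" using base bi by auto
            moreover have "- coeff g l / coeff g n \<in> \<rat>" using g(2) by auto
            then obtain r where "- coeff g l / coeff g n = of_rat r" by (blast elim: Rats_cases)
            ultimately show "- coeff g l / coeff g n * (b * a ^ l) \<in> T" using T_scale by metis
          qed
          finally show ?thesis by simp
        qed
      qed
      show "rat_vs.subspace {t. a * t \<in> T}"
        unfolding rat_vs.subspace_def using T_add T_scale T_0
        by (auto simp: distrib_left mult.left_commute[of a])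
    qed
    then show ?thesis using that by (auto simp: T_def)
  qed
  have "x * a ^ i \<in> T" if "x \<in> F" for x i
    using FT[OF that] step by (induction i) (auto simp: mult.left_commute[of x a])
  then have "adjoin F a \<subseteq> T"
    by (auto simp: adjoin_def poly_over_def poly_altdef intro!: T_sum)
  moreover have "finite B'" using B by (simp add: B'_def)
  ultimately show ?thesis by (auto simp: finite_dimensional_def T_def)
qed

subsection \<open>Field embeddings\<close>

locale subfield_embedding = subring_set F for F :: "complex set" +
  fixes \<sigma> :: "complex \<Rightarrow> complex"
  assumes subfield: "is_subfield F" and embedding: "\<sigma> \<in> field_embeddings F"
begin

lemma inverse_mem: "x \<in> F \<Longrightarrow> inverse x \<in> F"
  using subfield by (auto simp: is_subfield_def)

lemma hom_add: "x \<in> F \<Longrightarrow> y \<in> F \<Longrightarrow> \<sigma> (x + y) = \<sigma> x + \<sigma> y"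
  and hom_mult: "x \<in> F \<Longrightarrow> y \<in> F \<Longrightarrow> \<sigma> (x * y) = \<sigma> x * \<sigma> y"
  and hom_1 [simp]: "\<sigma> 1 = 1"
  and hom_outside: "x \<notin> F \<Longrightarrow> \<sigma> x = 0"
  using embedding by (auto simp: field_embeddings_def)

lemma hom_0 [simp]: "\<sigma> 0 = 0"
  using hom_add[of 0 0] by simp

lemma hom_uminus: "x \<in> F \<Longrightarrow> \<sigma> (- x) = - \<sigma> x"
  using hom_add[of x "- x"] uminus_mem[of x] by (simp add: eq_neg_iff_add_eq_0 add.commute)

lemma hom_sum: "(\<And>i. i \<in> I \<Longrightarrow> f i \<in> F) \<Longrightarrow> \<sigma> (sum f I) = (\<Sum>i\<in>I. \<sigma> (f i))"
  by (induction I rule: infinite_finite_induct) (auto simp: hom_add sum_mem)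

lemma hom_power: "x \<in> F \<Longrightarrow> \<sigma> (x ^ n) = \<sigma> x ^ n"
  by (induction n) (auto simp: hom_mult power_mem)

lemma hom_inverse: "x \<in> F \<Longrightarrow> \<sigma> (inverse x) = inverse (\<sigma> x)"
proof (cases "x = 0")
  case False
  assume "x \<in> F"
  then have "\<sigma> x * \<sigma> (inverse x) = 1"
    using hom_mult[of x "inverse x"] inverse_mem[of x] False by simp
  then show ?thesis by (metis inverse_unique)
qed auto

lemma hom_eq_0_iff: "x \<in> F \<Longrightarrow> \<sigma> x = 0 \<longleftrightarrow> x = 0"
  using hom_mult[of x "inverse x"] inverse_mem[of x] by (cases "x = 0") auto

lemma hom_inj: "inj_on \<sigma> F"
proof (rule inj_onI)
  fix x y assume "x \<in> F" "y \<in> F" "\<sigma> x = \<sigma> y"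
  then have "\<sigma> (x - y) = 0" using hom_add[of x "- y"] hom_uminus uminus_mem by simp
  then show "x = y" using hom_eq_0_iff[of "x - y"] diff_mem \<open>x \<in> F\<close> \<open>y \<in> F\<close> by simp
qed

lemma hom_of_nat: "\<sigma> (of_nat n) = of_nat n"
  by (induction n) (auto simp: hom_add of_nat_mem)

lemma hom_of_int: "\<sigma> (of_int n) = of_int n"
  by (cases n) (auto simp: hom_of_nat hom_uminus of_nat_mem simp del: of_nat_Suc)

lemma hom_Rats: "x \<in> \<rat> \<Longrightarrow> \<sigma> x = x"
  by (erule Rats_cases')
    (auto simp: divide_inverse hom_mult hom_inverse hom_of_int of_int_mem inverse_mem)

lemma coeff_map_hom [simp]: "coeff (map_poly \<sigma> h) i = \<sigma> (coeff h i)"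
  by (simp add: coeff_map_poly)

lemma map_hom_add: "p \<in> poly_over F \<Longrightarrow> q \<in> poly_over F \<Longrightarrow>
    map_poly \<sigma> (p + q) = map_poly \<sigma> p + map_poly \<sigma> q"
  by (rule poly_eqI) (auto simp: poly_over_def hom_add)

lemma map_hom_diff: "p \<in> poly_over F \<Longrightarrow> q \<in> poly_over F \<Longrightarrow>
    map_poly \<sigma> (p - q) = map_poly \<sigma> p - map_poly \<sigma> q"
  using map_hom_add[of "p - q" q] poly_over_diff[of p q] by simp

lemma map_hom_mult: "p \<in> poly_over F \<Longrightarrow> q \<in> poly_over F \<Longrightarrow>
    map_poly \<sigma> (p * q) = map_poly \<sigma> p * map_poly \<sigma> q"
  by (rule poly_eqI) (auto simp: poly_over_def coeff_mult hom_sum hom_mult mult_mem)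

lemma map_hom_Rats: "p \<in> poly_over \<rat> \<Longrightarrow> map_poly \<sigma> p = p"
  by (rule poly_eqI) (auto simp: poly_over_def hom_Rats)

lemma hom_poly:
  assumes "p \<in> poly_over F" "x \<in> F"
  shows "\<sigma> (poly p x) = poly (map_poly \<sigma> p) (\<sigma> x)"
proof -
  have deg: "degree (map_poly \<sigma> p) \<le> degree p" by (rule degree_le) (simp add: coeff_eq_0)
  have "\<sigma> (poly p x) = (\<Sum>i\<le>degree p. \<sigma> (coeff p i) * \<sigma> x ^ i)"
    using assms by (simp add: poly_altdef hom_sum hom_mult hom_power poly_over_def mult_mem power_mem)
  also have "\<dots> = poly (map_poly \<sigma> p) (\<sigma> x)"
    unfolding poly_altdef coeff_map_hom using deg coeff_eq_0[of "map_poly \<sigma> p"]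
    by (intro sum.mono_neutral_right) auto
  finally show ?thesis .
qed

text \<open>The hypothesis makes the assignment of (\<sigma>h)(b) to h(a) independent of
  \<open>h\<close>, so any representative may be chosen by \<open>SOME\<close>.\<close>

lemma extend_to_adjoin:
  assumes ab: "\<And>h. h \<in> poly_over F \<Longrightarrow> poly h a = 0 \<Longrightarrow> poly (map_poly \<sigma> h) b = 0"
  obtains \<tau> where "\<tau> \<in> field_embeddings (adjoin F a)" "\<And>x. x \<in> F \<Longrightarrow> \<tau> x = \<sigma> x" "\<tau> a = b"
proof -
  define \<tau> where "\<tau> x = (if x \<in> adjoin F a
      then poly (map_poly \<sigma> (SOME h. h \<in> poly_over F \<and> poly h a = x)) b else 0)" for x
  have \<tau>: "\<tau> (poly h a) = poly (map_poly \<sigma> h) b" if h: "h \<in> poly_over F" for h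
  proof -
    define g where "g = (SOME g. g \<in> poly_over F \<and> poly g a = poly h a)"
    have g: "g \<in> poly_over F" "poly g a = poly h a"
      using someI[of "\<lambda>g. g \<in> poly_over F \<and> poly g a = poly h a" h] h by (auto simp: g_def)
    have "poly (map_poly \<sigma> (g - h)) b = 0" using g h by (intro ab poly_over_diff) auto
    then have "poly (map_poly \<sigma> g) b = poly (map_poly \<sigma> h) b" using g h by (simp add: map_hom_diff)
    moreover have "poly h a \<in> adjoin F a" using h by (auto simp: adjoin_def)
    ultimately show ?thesis by (simp add: \<tau>_def g_def)
  qed
  have \<tau>F: "\<tau> x = \<sigma> x" if "x \<in> F" for x
    using \<tau>[of "[:x:]"] that poly_over_pCons[OF _ poly_over_0] by (simp add: map_poly_pCons)
  have "\<tau> \<in> field_embeddings (adjoin F a)"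
    unfolding field_embeddings_def
  proof (intro CollectI conjI ballI allI impI)
    fix x y assume "x \<in> adjoin F a" "y \<in> adjoin F a"
    then obtain p q where pq: "p \<in> poly_over F" "x = poly p a" "q \<in> poly_over F" "y = poly q a"
      by (auto simp: adjoin_def)
    show "\<tau> (x + y) = \<tau> x + \<tau> y"
      using \<tau>[OF poly_over_add[OF pq(1,3)]] pq by (simp add: \<tau> map_hom_add)
    show "\<tau> (x * y) = \<tau> x * \<tau> y"
      using \<tau>[OF poly_over_mult[OF pq(1,3)]] pq by (simp add: \<tau> map_hom_mult)
  qed (auto simp: \<tau>F, simp add: \<tau>_def)
  moreover have "\<tau> a = b"
    using \<tau>[of "[:0, 1:]"] by (simp add: poly_over_pCons poly_over_0 map_poly_pCons)
  ultimately show thesis using \<tau>F that by blast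
qed

text \<open>Let \<open>g\<close> be of least degree over \<open>F\<close> with root
  \<open>a\<close>. Its image under \<open>\<sigma>\<close> is not constant because
  \<open>\<sigma>\<close> is injective, so it has a complex root \<open>b\<close>. Every
  \<open>h\<close> vanishing at \<open>a\<close> is a multiple of \<open>g\<close>, hence its image
  vanishes at \<open>b\<close>.\<close>

lemma exists_conjugate_image:
  assumes "algebraic a"
  obtains b where "\<And>h. h \<in> poly_over F \<Longrightarrow> poly h a = 0 \<Longrightarrow> poly (map_poly \<sigma> h) b = 0"
proof -
  have "\<exists>g. g \<in> poly_over F \<and> g \<noteq> 0 \<and> poly g a = 0"
    using assms Ints_subset unfolding algebraic_def poly_over_def by blast
  then obtain g where g: "g \<in> poly_over F" "g \<noteq> 0" "poly g a = 0"
    and min: "\<And>h. h \<in> poly_over F \<Longrightarrow> h \<noteq> 0 \<Longrightarrow> poly h a = 0 \<Longrightarrow> degree g \<le> degree h"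
    using ex_has_least_nat[of "\<lambda>g. g \<in> poly_over F \<and> g \<noteq> 0 \<and> poly g a = 0" _ degree] by blast
  have "degree g \<noteq> 0"
  proof
    assume "degree g = 0"
    then obtain c where "g = [:c:]" by (auto elim: degree_eq_zeroE)
    then show False using g by auto
  qed
  moreover have gF: "lead_coeff g \<in> F" using g by (auto simp: poly_over_def)
  then have "\<sigma> (lead_coeff g) \<noteq> 0" using g hom_eq_0_iff by auto
  then have "degree g \<le> degree (map_poly \<sigma> g)" by (intro le_degree) simp
  ultimately have "\<not> constant (poly (map_poly \<sigma> g))" by (simp add: constant_degree)
  then obtain b where b: "poly (map_poly \<sigma> g) b = 0" using fundamental_theorem_of_algebra by blast
  have "poly (map_poly \<sigma> h) b = 0" if "h \<in> poly_over F" "poly h a = 0" for h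
    using that
  proof (induction "degree h" arbitrary: h rule: less_induct)
    case less
    show ?case
    proof (cases "h = 0")
      case False
      then have le: "degree g \<le> degree h" using less.prems min by blast
      \<comment> \<open>One step of long division by \<open>g\<close>, done by hand to keep the
        coefficients in \<open>F\<close>.\<close>
      define m where "m = monom (lead_coeff h * inverse (lead_coeff g)) (degree h - degree g)"
      have m: "m \<in> poly_over F"
        using less.prems gF by (auto simp: m_def poly_over_def intro!: mult_mem inverse_mem)
      define h' where "h' = h - m * g"
      have h': "h' \<in> poly_over F" "poly h' a = 0"
        using less.prems g m by (auto simp: h'_def intro: poly_over_diff poly_over_mult)
      have "h' = 0 \<or> degree h' < degree h"
      proof (cases "h' = 0")
        case h'0: False
        have dm: "degree (m * g) \<le> degree h"
          using degree_mult_le[of m g] degree_monom_le[of "lead_coeff h * inverse (lead_coeff g)" "degree h - degree g"] le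
          by (simp add: m_def)
        have "coeff (m * g) (degree h) = lead_coeff h"
          using coeff_mult_degree_sum[of m g] g False le by (simp add: m_def degree_monom_eq)
        then have "coeff h' (degree h) = 0" by (simp add: h'_def)
        moreover have "degree h' \<le> degree h" unfolding h'_def using dm by (intro degree_diff_le) auto
        ultimately show ?thesis using h'0 by (metis leading_coeff_0_iff order_less_le)
      qed auto
      then have "poly (map_poly \<sigma> h') b = 0" using less.hyps[of h'] h' by auto
      moreover have "map_poly \<sigma> h = map_poly \<sigma> m * map_poly \<sigma> g + map_poly \<sigma> h'"
        using map_hom_add[OF poly_over_mult[OF m g(1)] h'(1)] map_hom_mult[OF m g(1)]
        by (simp add: h'_def)
      ultimately show ?thesis using b by simp
    qed simp
  qed
  then show thesis using that by blast
qed

end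

lemma subfield_embeddingI:
  "is_subfield F \<Longrightarrow> \<sigma> \<in> field_embeddings F \<Longrightarrow> subfield_embedding F \<sigma>"
  by unfold_locales (auto intro: subfield_imp_subring)

lemma subfield_adjoin:
  assumes "is_subfield F" "finite_dimensional F" "algebraic a"
  shows "is_subfield (adjoin F a)" "finite_dimensional (adjoin F a)"
proof -
  interpret subring_set F using assms by unfold_locales (rule subfield_imp_subring)
  show "finite_dimensional (adjoin F a)"
    using assms by (intro finite_dimensional_adjoin subfield_imp_subring)
  then show "is_subfield (adjoin F a)"
    using adjoin_subring Rats_subset_subfield[OF assms(1)] adjoin_subset[of a]
    by (intro subfield_if_finite_dimensional) auto
qed

text \<open>The elements of \<open>S\<close> are adjoined one at a time. Finite dimension is carried
  along because it is what makes the next adjunction a field.\<close>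

lemma extend_embedding:
  assumes "finite S" "\<And>s. s \<in> S \<Longrightarrow> algebraic s"
    and F: "is_subfield F" "finite_dimensional F" "\<sigma> \<in> field_embeddings F"
  shows "\<exists>\<tau>\<in>field_embeddings (field_generated (F \<union> S)). (\<forall>x\<in>F. \<tau> x = \<sigma> x) \<and>
    finite_dimensional (field_generated (F \<union> S))"
  using assms(1,2)
proof (induction rule: finite_induct)
  case empty
  have "field_generated F = F"
    using F(1) field_generated_least[of F F] field_generated_superset[of F] by auto
  then show ?case using F by auto
next
  case (insert s S)
  define L where "L = field_generated (F \<union> S)"
  obtain \<tau> where \<tau>: "\<tau> \<in> field_embeddings L" "\<forall>x\<in>F. \<tau> x = \<sigma> x" and L: "finite_dimensional L"
    using insert by (auto simp: L_def)
  have Lf: "is_subfield L" unfolding L_def by (rule subfield_field_generated)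
  interpret subfield_embedding L \<tau> using Lf \<tau>(1) by (rule subfield_embeddingI)
  have s: "algebraic s" using insert by simp
  obtain b where b: "\<And>h. h \<in> poly_over L \<Longrightarrow> poly h s = 0 \<Longrightarrow> poly (map_poly \<tau> h) b = 0"
    using exists_conjugate_image[OF s] by blast
  obtain \<rho> where \<rho>: "\<rho> \<in> field_embeddings (adjoin L s)" "\<And>x. x \<in> L \<Longrightarrow> \<rho> x = \<tau> x"
    using extend_to_adjoin[of s b] b by blast
  have FS: "F \<union> S \<subseteq> L" unfolding L_def by (rule field_generated_superset)
  have "adjoin L s = field_generated (F \<union> insert s S)"
  proof
    have "L \<subseteq> field_generated (F \<union> insert s S)"
      unfolding L_def using field_generated_superset[of "F \<union> insert s S"]
      by (intro field_generated_least subfield_field_generated) auto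
    then show "adjoin L s \<subseteq> field_generated (F \<union> insert s S)"
      using field_generated_superset[of "F \<union> insert s S"]
      by (intro adjoin_least subfield_imp_subring subfield_field_generated) auto
    show "field_generated (F \<union> insert s S) \<subseteq> adjoin L s"
      using FS adjoin_subset[of s] adjoin_mem[of s]
      by (intro field_generated_least subfield_adjoin Lf L s) auto
  qed
  moreover have "\<forall>x\<in>F. \<rho> x = \<sigma> x" using \<rho>(2) \<tau>(2) FS by auto
  ultimately show ?case using \<rho>(1) subfield_adjoin(2)[OF Lf L s] by auto
qed

subsection \<open>Minimal polynomials\<close>

abbreviation rpoly :: "rat poly \<Rightarrow> complex poly" where
  "rpoly \<equiv> map_poly of_rat"

lemma coeff_rpoly [simp]: "coeff (rpoly p) i = of_rat (coeff p i)"
  by (simp add: coeff_map_poly)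

lemma rpoly_add: "rpoly (p + q) = rpoly p + rpoly q"
  by (rule poly_eqI) (simp add: of_rat_add)

lemma rpoly_mult: "rpoly (p * q) = rpoly p * rpoly q"
  by (rule poly_eqI) (simp add: coeff_mult of_rat_sum of_rat_mult)

lemma rpoly_eq_0_iff: "rpoly p = 0 \<longleftrightarrow> p = 0"
  by (simp add: poly_eq_iff)

lemma rpoly_over_Rats: "rpoly p \<in> poly_over \<rat>"
  by (auto simp: poly_over_def)

lemma poly_over_Rats_imp_rpoly:
  assumes "h \<in> poly_over \<rat>"
  obtains p where "h = rpoly p"
proof -
  define r where "r c = (SOME q. c = complex_of_rat q)" for c
  have r: "of_rat (r c) = c" if "c \<in> \<rat>" for c
    using that someI_ex[of "\<lambda>q. c = complex_of_rat q"] by (auto simp: r_def elim: Rats_cases)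
  have "r 0 = 0" using r[of 0] by simp
  then have "h = rpoly (map_poly r h)"
    using assms by (intro poly_eqI) (auto simp: coeff_map_poly r poly_over_def)
  then show thesis by (rule that)
qed

lemma minimal_degree_root_poly_dvd:
  assumes "poly (rpoly m) a = 0" "m \<noteq> 0"
    and min: "\<And>h. h \<noteq> 0 \<Longrightarrow> poly (rpoly h) a = 0 \<Longrightarrow> degree m \<le> degree h"
    and h: "poly (rpoly h) a = 0"
  shows "m dvd h"
proof -
  have "rpoly h = rpoly (h div m) * rpoly m + rpoly (h mod m)"
    by (simp flip: rpoly_mult rpoly_add)
  then have "poly (rpoly (h mod m)) a = 0" using h assms(1) by simp
  then have "h mod m = 0"
    using min[of "h mod m"] degree_mod_less'[of m h] assms(2) by force
  then show ?thesis by auto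
qed

lemma exists_minimal_root_poly:
  assumes "algebraic a"
  obtains m where "poly (rpoly m) a = 0" "m \<noteq> 0"
    "\<And>h. poly (rpoly h) a = 0 \<Longrightarrow> m dvd h"
proof -
  obtain g where g: "g \<noteq> 0" "g \<in> poly_over \<rat>" "poly g a = 0"
    using assms by (auto simp: algebraic_altdef poly_over_def)
  then obtain p where "p \<noteq> 0 \<and> poly (rpoly p) a = 0"
    by (metis poly_over_Rats_imp_rpoly rpoly_eq_0_iff)
  then obtain m where m: "m \<noteq> 0" "poly (rpoly m) a = 0"
    "\<And>h. h \<noteq> 0 \<Longrightarrow> poly (rpoly h) a = 0 \<Longrightarrow> degree m \<le> degree h"
    using ex_has_least_nat[of "\<lambda>m. m \<noteq> 0 \<and> poly (rpoly m) a = 0" p degree] by blast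
  then have "m dvd h" if "poly (rpoly h) a = 0" for h
    using minimal_degree_root_poly_dvd that by blast
  then show thesis using m that by blast
qed

lemma rpoly_root_not_unit:
  assumes "poly (rpoly m) a = 0" "m \<noteq> 0"
  shows "\<not> m dvd 1"
proof
  assume "m dvd 1"
  then have "degree m = 0" using assms(2) by (simp add: is_unit_iff_degree)
  then obtain c where "m = [:c:]" by (auto elim: degree_eq_zeroE)
  then show False using assms by (simp add: map_poly_pCons)
qed

text \<open>A generator \<open>m\<close> of the polynomials vanishing at \<open>a\<close> divides
  \<open>p\<close>; irreducibility makes the cofactor a unit, so \<open>p\<close> divides everything
  that \<open>m\<close> divides.\<close>

lemma irreducible_rpoly_dvd:
  assumes "irreducible p" "poly (rpoly p) a = 0" "poly (rpoly h) a = 0"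
  shows "p dvd h"
proof -
  have "p \<noteq> 0" using assms(1) by auto
  then have "algebraic a"
    using assms(2) by (intro algebraicI'[of "rpoly p"]) (auto simp: rpoly_eq_0_iff)
  then obtain m where m: "poly (rpoly m) a = 0" "m \<noteq> 0" "\<And>h. poly (rpoly h) a = 0 \<Longrightarrow> m dvd h"
    using exists_minimal_root_poly by blast
  obtain r where r: "p = m * r" using m(3)[OF assms(2)] by (auto elim: dvdE)
  then have "r dvd 1" using irreducibleD[OF assms(1) r] rpoly_root_not_unit[OF m(1,2)] by auto
  then have "p dvd m" using r by (simp add: mult_unit_dvd_iff)
  then show ?thesis using m(3)[OF assms(3)] by (rule dvd_trans)
qed

text \<open>Existence and uniqueness behind the \<open>THE\<close> in the definition; the witness is
  the normalised generator of the polynomials vanishing at \<open>a\<close>.\<close>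

lemma min_poly_rat:
  assumes "algebraic a"
  shows "lead_coeff (min_poly_rat a) = 1" "irreducible (min_poly_rat a)"
    "poly (rpoly (min_poly_rat a)) a = 0"
proof -
  let ?P = "\<lambda>p. lead_coeff p = 1 \<and> irreducible p \<and> poly (rpoly p) a = 0"
  obtain m where m: "poly (rpoly m) a = 0" "m \<noteq> 0" "\<And>h. poly (rpoly h) a = 0 \<Longrightarrow> m dvd h"
    using exists_minimal_root_poly[OF assms] by blast
  define p where "p = smult (inverse (lead_coeff m)) m"
  have irr: "irreducible m"
  proof (rule irreducibleI)
    fix r s assume rs: "m = r * s"
    \<comment> \<open>If the factor \<open>r\<close> vanishes at \<open>a\<close>, then
      \<open>m\<close> divides it and the other factor is a unit.\<close>
    have *: "s dvd 1" if "poly (rpoly r) a = 0" "m = r * s" for r s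
    proof -
      have "m dvd r" using m(3)[OF that(1)] .
      then obtain t where "r = m * t" by (auto elim: dvdE)
      then have "r * (s * t) = r * 1" using that(2) by (simp add: mult_ac)
      then have "s * t = 1" using that(2) m(2) by (simp only: mult_cancel_left) auto
      then show ?thesis by (metis dvd_triv_left)
    qed
    have "poly (rpoly r) a = 0 \<or> poly (rpoly s) a = 0" using m(1) by (simp add: rs rpoly_mult)
    then show "r dvd 1 \<or> s dvd 1" using *[of r s] *[of s r] rs by (auto simp: mult.commute)
  qed (use m rpoly_root_not_unit in auto)
  have "?P p"
  proof (intro conjI)
    show "lead_coeff p = 1" using m(2) by (simp add: p_def)
    show "irreducible p"
    proof -
      have "p = [:inverse (lead_coeff m):] * m" by (simp add: p_def)
      moreover have "is_unit [:inverse (lead_coeff m):]" using m(2) by (simp add: is_unit_iff_degree)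
      ultimately show ?thesis using irr by (simp only: irreducible_mult_unit_left)
    qed
    have "rpoly p = smult (of_rat (inverse (lead_coeff m))) (rpoly m)"
      by (rule poly_eqI) (simp add: p_def of_rat_mult)
    then show "poly (rpoly p) a = 0" using m by simp
  qed
  moreover have "q = p" if "?P q" for q
  proof -
    have "p dvd q" using that \<open>?P p\<close> irreducible_rpoly_dvd[of p a q] by simp
    then obtain r where r: "q = p * r" by (auto elim: dvdE)
    moreover have "degree q \<le> degree p"
      using that \<open>?P p\<close> irreducible_rpoly_dvd[of q a p] by (intro dvd_imp_degree_le) auto
    moreover have "lead_coeff r = 1" using that \<open>?P p\<close> r by (simp add: lead_coeff_mult)
    moreover have "p \<noteq> 0" "r \<noteq> 0" using \<open>?P p\<close> \<open>lead_coeff r = 1\<close> by auto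
    ultimately have "degree r = 0" by (simp add: degree_mult_eq)
    then obtain c where "r = [:c:]" by (auto elim: degree_eq_zeroE)
    then show ?thesis using r \<open>lead_coeff r = 1\<close> by simp
  qed
  ultimately have "?P (min_poly_rat a)"
    unfolding min_poly_rat_def by (rule theI)
  then show "lead_coeff (min_poly_rat a) = 1" "irreducible (min_poly_rat a)"
    "poly (rpoly (min_poly_rat a)) a = 0" by auto
qed

section \<open>Conjugates as the simple roots of the minimal polynomial\<close>

context
  fixes a :: complex
  assumes alg: "algebraic a"
begin

lemma finite_galois_conjugates: "finite (galois_conjugates a)"
proof -
  have "rpoly (min_poly_rat a) \<noteq> 0"
    using min_poly_rat(2)[OF alg] by (auto simp: rpoly_eq_0_iff)
  then show ?thesis unfolding galois_conjugates_def by (rule poly_roots_finite)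
qed

lemma algebraic_galois_conjugates: "x \<in> galois_conjugates a \<Longrightarrow> algebraic x"
  using min_poly_rat(2)[OF alg]
  by (intro algebraicI'[of "rpoly (min_poly_rat a)"])
    (auto simp: galois_conjugates_def rpoly_eq_0_iff)

lemma galois_conjugates_same_roots:
  assumes "x \<in> galois_conjugates a" "y \<in> galois_conjugates a" "h \<in> poly_over \<rat>" "poly h x = 0"
  shows "poly h y = 0"
proof -
  obtain h' where h': "h = rpoly h'" using assms(3) by (rule poly_over_Rats_imp_rpoly)
  have "min_poly_rat a dvd h'"
    using irreducible_rpoly_dvd[OF min_poly_rat(2)[OF alg], of x h'] assms h'
    by (simp add: galois_conjugates_def)
  then show ?thesis
    using assms(2) by (auto simp: h' rpoly_mult galois_conjugates_def elim!: dvdE)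
qed

text \<open>Separability in characteristic 0: a repeated root would make the irreducible polynomial
  divide its own derivative, which has smaller degree.\<close>

lemma prod_galois_conjugates: "(\<Prod>z\<in>galois_conjugates a. [:- z, 1:]) = rpoly (min_poly_rat a)"
proof -
  define p where "p = min_poly_rat a"
  note p = min_poly_rat[OF alg, folded p_def]
  have "p \<noteq> 0" using p(2) by auto
  have lead: "lead_coeff (rpoly p) = 1"
  proof -
    have "degree (rpoly p) = degree p" by (rule degree_map_poly) auto
    then show ?thesis using p(1) by simp
  qed
  have "rsquarefree (rpoly p)"
    unfolding rsquarefree_roots
  proof (intro allI notI, elim conjE)
    fix z assume z: "poly (rpoly p) z = 0" "poly (pderiv (rpoly p)) z = 0"
    have "pderiv (rpoly p) = rpoly (pderiv p)"
      by (rule poly_eqI) (simp add: coeff_pderiv of_rat_mult of_rat_add)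
    then have "p dvd pderiv p" using irreducible_rpoly_dvd[OF p(2) z(1), of "pderiv p"] z(2) by simp
    moreover have "degree p \<noteq> 0"
      using \<open>p \<noteq> 0\<close> rpoly_root_not_unit[OF z(1)] by (simp add: is_unit_iff_degree)
    ultimately show False using not_dvd_pderiv by blast
  qed
  then have "smult (lead_coeff (rpoly p)) (\<Prod>z|poly (rpoly p) z = 0. [:- z, 1:]) = rpoly p"
    by (rule complex_poly_decompose_rsquarefree)
  then show ?thesis unfolding lead smult_1_left by (simp only: galois_conjugates_def p_def)
qed

end

subsection \<open>The Galois action on the conjugates\<close>

text \<open>The elements on which two embeddings agree form a subfield containing the
  generators.\<close>

lemma embeddings_agree:
  assumes "\<sigma> \<in> field_embeddings (field_generated C)" "\<tau> \<in> field_embeddings (field_generated C)"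
    and "\<And>x. x \<in> C \<Longrightarrow> \<sigma> x = \<tau> x"
  shows "\<sigma> = \<tau>"
proof
  fix x
  define K where "K = field_generated C"
  have K: "is_subfield K" unfolding K_def by (rule subfield_field_generated)
  interpret s: subfield_embedding K \<sigma> using K assms(1) unfolding K_def by (rule subfield_embeddingI)
  interpret t: subfield_embedding K \<tau> using K assms(2) unfolding K_def by (rule subfield_embeddingI)
  have "is_subfield {x\<in>K. \<sigma> x = \<tau> x}"
    unfolding is_subfield_def
    by (auto intro: s.add_mem s.mult_mem s.uminus_mem s.inverse_mem
        simp: s.hom_add t.hom_add s.hom_mult t.hom_mult s.hom_uminus t.hom_uminus
          s.hom_inverse t.hom_inverse)
  then have "K \<subseteq> {x\<in>K. \<sigma> x = \<tau> x}"
    using assms(3) field_generated_superset[of C]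
    unfolding K_def by (intro field_generated_least) auto
  then show "\<sigma> x = \<tau> x"
    by (cases "x \<in> K") (auto simp: s.hom_outside t.hom_outside)
qed

text \<open>The primitive element argument: \<open>\<theta>\<close> combines the generators with
  powers of a natural number \<open>t\<close> that avoids the finitely many roots of the polynomials
  \<open>q \<sigma> \<tau>\<close>.\<close>

lemma exists_separating_element:
  assumes C: "finite C" and E: "finite E" "E \<subseteq> field_embeddings (field_generated C)"
  obtains \<theta> where "\<theta> \<in> field_generated C" "inj_on (\<lambda>\<sigma>. \<sigma> \<theta>) E"
proof -
  define K where "K = field_generated C"
  have K: "is_subfield K" unfolding K_def by (rule subfield_field_generated)
  interpret subring_set K using K by unfold_locales (rule subfield_imp_subring)
  obtain g n where g: "C = g ` {i::nat. i < n}" "inj_on g {i. i < n}"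
    using finite_imp_nat_seg_image_inj_on[OF C] by auto
  have gK: "g i \<in> K" if "i < n" for i
    using that g(1) field_generated_superset[of C] by (auto simp: K_def)
  \<comment> \<open>At \<open>t\<close> this polynomial takes the value
    \<open>\<sigma> \<theta> - \<tau> \<theta>\<close>. It is nonzero for distinct embeddings
    because they differ on a generator.\<close>
  define q where "q \<sigma> \<tau> = (\<Sum>i<n. monom (\<sigma> (g i) - \<tau> (g i)) i)" for \<sigma> \<tau> :: "complex \<Rightarrow> complex"
  have coeff_q: "coeff (q \<sigma> \<tau>) i = (if i < n then \<sigma> (g i) - \<tau> (g i) else 0)" for \<sigma> \<tau> i
    by (simp add: q_def coeff_sum)
  have q0: "q \<sigma> \<tau> \<noteq> 0" if "\<sigma> \<in> E" "\<tau> \<in> E" "\<sigma> \<noteq> \<tau>" for \<sigma> \<tau>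
  proof
    assume "q \<sigma> \<tau> = 0"
    then have "\<sigma> (g i) = \<tau> (g i)" if "i < n" for i using coeff_q[of \<sigma> \<tau> i] that by simp
    then have "\<sigma> = \<tau>" using that E(2) by (intro embeddings_agree[of \<sigma> C \<tau>]) (auto simp: g(1))
    with that show False by simp
  qed
  define Z where "Z = (\<Union>\<sigma>\<in>E. \<Union>\<tau>\<in>E - {\<sigma>}. {z. poly (q \<sigma> \<tau>) z = 0})"
  have "finite Z" unfolding Z_def using E(1) q0 by (auto intro!: poly_roots_finite)
  moreover have "infinite (range (of_nat :: nat \<Rightarrow> complex))"
    by (simp add: finite_image_iff inj_on_def)
  ultimately obtain t :: nat where t: "of_nat t \<notin> Z"
    by (metis (no_types, lifting) image_subset_iff rev_finite_subset)
  define \<theta> where "\<theta> = (\<Sum>i<n. of_nat t ^ i * g i)"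
  have "\<theta> \<in> K" unfolding \<theta>_def by (intro sum_mem mult_mem power_mem of_nat_mem gK) auto
  moreover have hom: "\<sigma> \<theta> = (\<Sum>i<n. of_nat t ^ i * \<sigma> (g i))" if "\<sigma> \<in> E" for \<sigma>
  proof -
    have "\<sigma> \<in> field_embeddings K" using that E(2) by (auto simp: K_def)
    then interpret s: subfield_embedding K \<sigma> by (rule subfield_embeddingI[OF K])
    have "\<sigma> \<theta> = (\<Sum>i<n. \<sigma> (of_nat t ^ i * g i))"
      unfolding \<theta>_def using gK by (intro s.hom_sum mult_mem power_mem of_nat_mem) auto
    also have "\<dots> = (\<Sum>i<n. of_nat t ^ i * \<sigma> (g i))"
      using gK by (intro sum.cong) (auto simp: s.hom_mult s.hom_power s.hom_of_nat power_mem of_nat_mem)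
    finally show ?thesis .
  qed
  have "inj_on (\<lambda>\<sigma>. \<sigma> \<theta>) E"
  proof (rule inj_onI, rule ccontr)
    fix \<sigma> \<tau> assume st: "\<sigma> \<in> E" "\<tau> \<in> E" "\<sigma> \<theta> = \<tau> \<theta>" "\<sigma> \<noteq> \<tau>"
    have "poly (q \<sigma> \<tau>) (of_nat t) = (\<Sum>i<n. of_nat t ^ i * \<sigma> (g i)) - (\<Sum>i<n. of_nat t ^ i * \<tau> (g i))"
      by (simp add: q_def poly_sum poly_monom sum_subtractf[symmetric] algebra_simps)
    also have "\<dots> = 0" using st hom by simp
    finally have "of_nat t \<in> Z" using st by (auto simp: Z_def)
    with t show False by simp
  qed
  ultimately show thesis using that by (simp add: K_def)
qed

text \<open>The first \<open>card E\<close> powers of a separating element are independent: a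
  rational relation among them would be a nonzero polynomial of degree below \<open>card E\<close>
  with the \<open>card E\<close> distinct roots \<open>\<sigma> \<theta>\<close>.\<close>

lemma card_embeddings_le_degree:
  assumes C: "finite C" and fin: "finite_dimensional (field_generated C)"
    and E: "finite E" "E \<subseteq> field_embeddings (field_generated C)"
  shows "card E \<le> field_degree (field_generated C)"
proof -
  define K where "K = field_generated C"
  have K: "is_subfield K" unfolding K_def by (rule subfield_field_generated)
  interpret subring_set K using K by unfold_locales (rule subfield_imp_subring)
  obtain \<theta> where \<theta>: "\<theta> \<in> K" "inj_on (\<lambda>\<sigma>. \<sigma> \<theta>) E"
    using exists_separating_element[OF C E] by (auto simp: K_def)
  have zero: "h = 0" if h: "h \<in> poly_over \<rat>" "poly h \<theta> = 0" "degree h < card E" for h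
  proof (rule ccontr)
    assume "h \<noteq> 0"
    have "poly h (\<sigma> \<theta>) = 0" if "\<sigma> \<in> E" for \<sigma>
    proof -
      have "\<sigma> \<in> field_embeddings K" using that E(2) by (auto simp: K_def)
      then interpret s: subfield_embedding K \<sigma> by (rule subfield_embeddingI[OF K])
      have "h \<in> poly_over K" using h(1) Rats_subset_subfield[OF K] by (auto simp: poly_over_def)
      then show ?thesis using s.hom_poly[of h \<theta>] \<theta>(1) h by (simp add: s.map_hom_Rats)
    qed
    then have "(\<lambda>\<sigma>. \<sigma> \<theta>) ` E \<subseteq> {z. poly h z = 0}" by auto
    then have "card E \<le> card {z. poly h z = 0}"
      using \<theta>(2) poly_roots_finite[OF \<open>h \<noteq> 0\<close>] by (metis card_image card_mono)
    also have "\<dots> \<le> degree h" using \<open>h \<noteq> 0\<close> by (rule card_poly_roots_bound)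
    finally show False using h(3) by simp
  qed
  define A where "A = (\<lambda>i. \<theta> ^ i) ` {..<card E}"
  have inj: "inj_on (\<lambda>i. \<theta> ^ i) {..<card E}"
  proof (rule inj_onI, rule ccontr)
    fix i j assume ij: "i \<in> {..<card E}" "j \<in> {..<card E}" "\<theta> ^ i = \<theta> ^ j" "i \<noteq> j"
    define h where "h = (monom 1 i - monom 1 j :: complex poly)"
    have "degree h \<le> max i j"
      unfolding h_def by (intro degree_diff_le) (auto intro: order.trans[OF degree_monom_le])
    then have "h = 0" using ij by (intro zero) (auto simp: h_def poly_over_def poly_monom)
    moreover have "coeff h i = 1" using ij by (simp add: h_def)
    ultimately show False by simp
  qed
  have indep: "rat_vs.independent A"
  proof (rule rat_vs.independent_if_scalars_zero)
    fix f x assume f: "(\<Sum>x\<in>A. of_rat (f x) * x) = 0" and x: "x \<in> A"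
    define h where "h = (\<Sum>i<card E. monom (complex_of_rat (f (\<theta> ^ i))) i)"
    have ch: "coeff h i = (if i < card E then of_rat (f (\<theta> ^ i)) else 0)" for i
      by (simp add: h_def coeff_sum)
    obtain i where i: "i < card E" "x = \<theta> ^ i" using x by (auto simp: A_def)
    have "degree h \<le> card E - 1" by (rule degree_le) (auto simp: ch)
    then have "degree h < card E" using i by simp
    moreover have "poly h \<theta> = 0"
      using f inj by (simp add: h_def A_def sum.reindex poly_sum poly_monom)
    ultimately have "h = 0" by (intro zero) (auto simp: ch poly_over_def)
    then show "f x = 0" using ch[of i] i by simp
  qed (simp add: A_def)
  obtain B where B: "finite B" "K \<subseteq> rat_vs.span B"
    using fin by (auto simp: finite_dimensional_def K_def)
  obtain B' where B': "B' \<subseteq> K" "rat_vs.independent B'" "K \<subseteq> rat_vs.span B'" "card B' = rat_vs.dim K"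
    using rat_vs.basis_exists by blast
  have "finite B'" using rat_vs.independent_span_bound[OF B(1) B'(2)] B' B by auto
  moreover have "A \<subseteq> K" using \<theta>(1) by (auto simp: A_def intro: power_mem)
  ultimately have "card A \<le> card B'"
    using rat_vs.independent_span_bound[OF _ indep, of B'] B' by auto
  moreover have "card A = card E" using inj by (simp add: A_def card_image)
  ultimately show ?thesis using B'(4) by (simp add: field_degree_def K_def)
qed

section \<open>Transitivity, normality and equidistribution of the embeddings\<close>

context
  fixes a :: complex
  assumes alg: "algebraic a"
begin

text \<open>Conjugates are roots of the same rational polynomials, so the embedding of the rationals
  extends to the field generated by \<open>x\<close> with \<open>y\<close> as image of
  \<open>x\<close>, and from there to the closure.\<close>

lemma galois_closure_transitive:
  assumes "x \<in> galois_conjugates a" "y \<in> galois_conjugates a"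
  shows "\<exists>\<tau>\<in>field_embeddings (galois_closure a). \<tau> x = y"
    and "finite_dimensional (galois_closure a)"
proof -
  define i where "i z = (if z \<in> \<rat> then z else 0 :: complex)" for z
  have "i \<in> field_embeddings \<rat>" by (auto simp: i_def field_embeddings_def)
  with subfield_Rats interpret subfield_embedding \<rat> i by (rule subfield_embeddingI)
  have "poly (map_poly i h) y = 0" if "h \<in> poly_over \<rat>" "poly h x = 0" for h
    using galois_conjugates_same_roots[OF alg assms that] that(1) by (simp add: map_hom_Rats)
  then obtain \<sigma> where \<sigma>: "\<sigma> \<in> field_embeddings (adjoin \<rat> x)" "\<sigma> x = y"
    using extend_to_adjoin[of x y] by blast
  define F where "F = adjoin \<rat> x"
  have F: "is_subfield F" "finite_dimensional F"
    unfolding F_def using assms algebraic_galois_conjugates[OF alg]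
    by (auto intro!: subfield_adjoin subfield_Rats finite_dimensional_Rats)
  have "F \<subseteq> galois_closure a"
    unfolding F_def galois_closure_def using assms field_generated_superset
    by (intro adjoin_least subfield_imp_subring subfield_field_generated Rats_subset_subfield) auto
  then have eq: "field_generated (F \<union> galois_conjugates a) = galois_closure a"
    unfolding galois_closure_def
    using field_generated_superset[of "F \<union> galois_conjugates a"]
      field_generated_superset[of "galois_conjugates a"]
    by (intro antisym field_generated_least subfield_field_generated) auto
  obtain \<tau> where \<tau>: "\<tau> \<in> field_embeddings (galois_closure a)" "\<forall>z\<in>F. \<tau> z = \<sigma> z"
      "finite_dimensional (galois_closure a)"
    using extend_embedding[OF finite_galois_conjugates[OF alg] algebraic_galois_conjugates[OF alg] F \<sigma>(1)[folded F_def]]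
    unfolding eq by blast
  moreover have "x \<in> F" unfolding F_def by (rule adjoin_mem)
  ultimately show "\<exists>\<tau>\<in>field_embeddings (galois_closure a). \<tau> x = y"
    and "finite_dimensional (galois_closure a)" using \<sigma>(2) by auto
qed

lemma embedding_galois_conjugates:
  assumes "\<sigma> \<in> field_embeddings (galois_closure a)" "x \<in> galois_conjugates a"
  shows "\<sigma> x \<in> galois_conjugates a"
proof -
  have K: "is_subfield (galois_closure a)"
    unfolding galois_closure_def by (rule subfield_field_generated)
  interpret subfield_embedding "galois_closure a" \<sigma> using K assms(1) by (rule subfield_embeddingI)
  let ?P = "rpoly (min_poly_rat a)"
  have "?P \<in> poly_over (galois_closure a)"
    using rpoly_over_Rats Rats_subset_subfield[OF K] by (auto simp: poly_over_def)
  moreover have "x \<in> galois_closure a"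
    using assms(2) field_generated_superset by (auto simp: galois_closure_def)
  ultimately show ?thesis
    using hom_poly[of ?P x] assms(2) by (simp add: map_hom_Rats rpoly_over_Rats galois_conjugates_def)
qed

text \<open>Normality of the closure: the elements that \<open>\<sigma>\<close> maps into it form a
  subfield containing the conjugates.\<close>

lemma embedding_galois_closure:
  assumes "\<sigma> \<in> field_embeddings (galois_closure a)" "x \<in> galois_closure a"
  shows "\<sigma> x \<in> galois_closure a"
proof -
  define K where "K = galois_closure a"
  have K: "is_subfield K"
    unfolding K_def galois_closure_def by (rule subfield_field_generated)
  interpret subfield_embedding K \<sigma> using K assms(1)[folded K_def] by (rule subfield_embeddingI)
  have "is_subfield {x\<in>K. \<sigma> x \<in> K}"
    unfolding is_subfield_def
    by (auto intro: add_mem mult_mem uminus_mem inverse_mem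
        simp: hom_add hom_mult hom_uminus hom_inverse)
  moreover have CK: "galois_conjugates a \<subseteq> K"
    unfolding K_def galois_closure_def by (rule field_generated_superset)
  ultimately have "K \<subseteq> {x\<in>K. \<sigma> x \<in> K}"
    using embedding_galois_conjugates[OF assms(1)] unfolding K_def galois_closure_def
    by (intro field_generated_least) auto
  then show ?thesis using assms(2) by (auto simp: K_def)
qed

lemma finite_embeddings_galois_closure: "finite (field_embeddings (galois_closure a))"
proof -
  let ?C = "galois_conjugates a"
  have "inj_on (\<lambda>\<sigma>. restrict \<sigma> ?C) (field_embeddings (galois_closure a))"
  proof (rule inj_onI)
    fix \<sigma> \<tau> assume "\<sigma> \<in> field_embeddings (galois_closure a)" "\<tau> \<in> field_embeddings (galois_closure a)"
      "restrict \<sigma> ?C = restrict \<tau> ?C"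
    then show "\<sigma> = \<tau>"
      unfolding galois_closure_def by (intro embeddings_agree[of \<sigma> ?C \<tau>]) (auto dest: fun_cong simp: restrict_def split: if_splits)
  qed
  moreover have "(\<lambda>\<sigma>. restrict \<sigma> ?C) ` field_embeddings (galois_closure a) \<subseteq> ?C \<rightarrow>\<^sub>E ?C"
    using embedding_galois_conjugates by auto
  moreover have "finite (?C \<rightarrow>\<^sub>E ?C)"
    using finite_galois_conjugates[OF alg] by (intro finite_PiE) auto
  ultimately show ?thesis by (metis finite_imageD finite_subset)
qed

text \<open>Composition with an embedding \<open>\<tau>\<close> taking \<open>y\<close> to
  \<open>z\<close> injects the first fibre into the second.\<close>

lemma card_fibres_le:
  assumes x: "x \<in> galois_conjugates a" and yz: "y \<in> galois_conjugates a" "z \<in> galois_conjugates a"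
  shows "card {\<sigma>\<in>field_embeddings (galois_closure a). \<sigma> x = y}
    \<le> card {\<sigma>\<in>field_embeddings (galois_closure a). \<sigma> x = z}"
proof -
  let ?K = "galois_closure a"
  have K: "is_subfield ?K" unfolding galois_closure_def by (rule subfield_field_generated)
  obtain \<tau> where \<tau>: "\<tau> \<in> field_embeddings ?K" "\<tau> y = z"
    using galois_closure_transitive(1)[OF yz] by blast
  interpret subfield_embedding ?K \<tau> using K \<tau>(1) by (rule subfield_embeddingI)
  have "\<tau> \<circ> \<sigma> \<in> field_embeddings ?K" if "\<sigma> \<in> field_embeddings ?K" for \<sigma>
    using that embedding_galois_closure[OF that]
    by (auto simp: field_embeddings_def hom_add hom_mult)
  moreover have "inj_on (\<lambda>\<sigma>. \<tau> \<circ> \<sigma>) (field_embeddings ?K)"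
  proof (rule inj_onI, rule ext)
    fix \<sigma> \<rho> x assume s: "\<sigma> \<in> field_embeddings ?K" "\<rho> \<in> field_embeddings ?K" "\<tau> \<circ> \<sigma> = \<tau> \<circ> \<rho>"
    show "\<sigma> x = \<rho> x"
    proof (cases "x \<in> ?K")
      case True
      have "\<tau> (\<sigma> x) = \<tau> (\<rho> x)" using s(3) by (metis comp_apply)
      then show ?thesis
        using hom_inj embedding_galois_closure[OF _ True] s by (auto dest: inj_onD)
    next
      case False
      then show ?thesis using s by (simp add: field_embeddings_def)
    qed
  qed
  ultimately show ?thesis
    using \<tau>(2) finite_embeddings_galois_closure
    by (intro card_inj_on_le[of "\<lambda>\<sigma>. \<tau> \<circ> \<sigma>"]) (auto intro: inj_on_subset)
qed

text \<open>All fibres of the evaluation at \<open>x\<close> have the same size, so each conjugate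
  is hit equally often. The divisibility makes the \<open>div\<close> exact.\<close>

lemma sum_embeddings_conjugate:
  assumes x: "x \<in> galois_conjugates a"
  shows "(\<Sum>\<sigma>\<in>field_embeddings (galois_closure a). g (\<sigma> x)) =
    of_nat (card (field_embeddings (galois_closure a)) div card (galois_conjugates a))
      * (\<Sum>z\<in>galois_conjugates a. g z :: complex)"
    and "card (galois_conjugates a) dvd card (field_embeddings (galois_closure a))"
proof -
  let ?E = "field_embeddings (galois_closure a)" and ?C = "galois_conjugates a"
  define m where "m = card {\<sigma>\<in>?E. \<sigma> x = x}"
  have m: "card {\<sigma>\<in>?E. \<sigma> x = z} = m" if "z \<in> ?C" for z
    unfolding m_def using card_fibres_le[OF x that x] card_fibres_le[OF x x that] by simp
  have fin: "finite ?E" "finite ?C"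
    using finite_embeddings_galois_closure finite_galois_conjugates[OF alg] by auto
  have maps: "(\<lambda>\<sigma>. \<sigma> x) ` ?E \<subseteq> ?C" using embedding_galois_conjugates x by auto
  have "card ?E = (\<Sum>z\<in>?C. card {\<sigma>\<in>?E. \<sigma> x = z})"
    using sum.group[OF fin maps, of "\<lambda>_. 1::nat"] by simp
  then have cE: "card ?E = card ?C * m" using m by simp
  have C0: "card ?C > 0" using x fin by (auto simp: card_gt_0_iff)
  have "(\<Sum>\<sigma>\<in>?E. g (\<sigma> x)) = (\<Sum>z\<in>?C. \<Sum>\<sigma>\<in>{\<sigma>\<in>?E. \<sigma> x = z}. g (\<sigma> x))"
    using sum.group[OF fin maps, of "\<lambda>\<sigma>. g (\<sigma> x)"] by simp
  also have "\<dots> = (\<Sum>z\<in>?C. of_nat m * g z)"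
    by (intro sum.cong) (auto simp: m)
  finally show "(\<Sum>\<sigma>\<in>?E. g (\<sigma> x)) = of_nat (card ?E div card ?C) * (\<Sum>z\<in>?C. g z)"
    using cE C0 by (simp add: sum_distrib_left)
  show "card ?C dvd card ?E" using cE by simp
qed

end

section \<open>Traces as multiples of power sums, and the conclusion\<close>

theorem theorem2p10:
  fixes \<alpha> :: "nat \<Rightarrow> complex" and b :: "nat \<Rightarrow> int" and k :: nat
  assumes "algebraic (\<alpha> 1)" and "\<alpha> 1 \<noteq> 0"
    and "k \<ge> 2"
    and "bij_betw \<alpha> {1..k} (galois_conjugates (\<alpha> 1))"
    and "(\<Sum>i=1..k. b i) \<noteq> 0"
    and "\<forall>j::nat. 1 \<le> j \<and>
           int j \<le> int (field_degree (galois_closure (\<alpha> 1)))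
                   + int (field_degree (galois_closure (\<alpha> 1)))
                     * \<lfloor>log 2 (real_of_int (\<bar>\<Sum>i=1..k. b i\<bar>
                              * int (field_degree (galois_closure (\<alpha> 1)))))\<rfloor> + 1
         \<longrightarrow> field_trace (galois_closure (\<alpha> 1)) (\<Sum>i=1..k. of_int (b i) * \<alpha> i ^ j) \<in> \<int>"
  shows "algebraic_int (\<alpha> 1) \<and> (\<forall>i\<in>{1..k}. algebraic_int (\<alpha> i))"
proof -
  define a where "a = \<alpha> 1"
  define C where "C = galois_conjugates a"
  define K where "K = galois_closure a"
  define E where "E = field_embeddings K"
  define d where "d = field_degree K"
  define n where "n = (\<Sum>i=1..k. b i)"
  define m where "m = card E div card C"
  have alg: "algebraic a" using assms(1) by (simp add: a_def)
  have bij: "bij_betw \<alpha> {1..k} C" using assms(4) by (simp add: C_def a_def)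
  have aC: "a \<in> C" using bij assms(3) by (auto simp: bij_betw_def a_def)
  have finC: "finite C" unfolding C_def by (rule finite_galois_conjugates[OF alg])
  have cardC: "card C = k" using bij_betw_same_card[OF bij] by simp
  have K: "is_subfield K" unfolding K_def galois_closure_def by (rule subfield_field_generated)
  have finE: "finite E" unfolding E_def K_def by (rule finite_embeddings_galois_closure[OF alg])
  have Ed: "card E \<le> d"
    using card_embeddings_le_degree[OF finC[unfolded C_def], of E] finE
      galois_closure_transitive(2)[OF alg aC[unfolded C_def] aC[unfolded C_def]]
    by (simp add: d_def K_def E_def galois_closure_def)
  have "E \<noteq> {}"
    using galois_closure_transitive(1)[OF alg aC[unfolded C_def] aC[unfolded C_def]]
    by (auto simp: E_def K_def)
  then have E0: "card E > 0" using finE by (simp add: card_gt_0_iff)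
  have Emk: "card E = m * k"
    using sum_embeddings_conjugate(2)[OF alg aC[unfolded C_def]] cardC
    by (simp add: m_def E_def K_def C_def)
  then have m0: "m > 0" using E0 by (cases m) auto
  have kd: "k \<le> d" using Emk m0 Ed by (metis dual_order.trans mult_le_mono1 mult_1 Suc_leI One_nat_def)
  have d0: "d > 0" using Ed E0 by simp
  \<comment> \<open>The trace of \<open>\<alpha> i ^ j\<close> is the same for every
    \<open>i\<close>, so the coefficients \<open>b i\<close> enter only through their sum
    \<open>n\<close>.\<close>
  have trace: "field_trace K (\<Sum>i=1..k. of_int (b i) * \<alpha> i ^ j) = of_int (n * int m) * (\<Sum>z\<in>C. z ^ j)" for j
  proof -
    have \<alpha>K: "\<alpha> i \<in> K" "\<alpha> i \<in> C" if "i \<in> {1..k}" for i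
      using bij that field_generated_superset[of C]
      by (auto simp: bij_betw_def K_def galois_closure_def C_def)
    have "\<sigma> (\<Sum>i=1..k. of_int (b i) * \<alpha> i ^ j) = (\<Sum>i=1..k. of_int (b i) * \<sigma> (\<alpha> i) ^ j)"
      if "\<sigma> \<in> E" for \<sigma>
    proof -
      interpret subfield_embedding K \<sigma> using K that unfolding E_def by (rule subfield_embeddingI)
      have "\<sigma> (\<Sum>i=1..k. of_int (b i) * \<alpha> i ^ j) = (\<Sum>i=1..k. \<sigma> (of_int (b i) * \<alpha> i ^ j))"
        using \<alpha>K(1) by (intro hom_sum mult_mem power_mem of_int_mem) auto
      also have "\<dots> = (\<Sum>i=1..k. of_int (b i) * \<sigma> (\<alpha> i) ^ j)"
        using \<alpha>K(1) by (intro sum.cong) (auto simp: hom_mult hom_power hom_of_int power_mem of_int_mem)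
      finally show ?thesis .
    qed
    then have "field_trace K (\<Sum>i=1..k. of_int (b i) * \<alpha> i ^ j)
        = (\<Sum>\<sigma>\<in>E. \<Sum>i=1..k. of_int (b i) * \<sigma> (\<alpha> i) ^ j)"
      by (simp add: field_trace_def E_def)
    also have "\<dots> = (\<Sum>i=1..k. of_int (b i) * (\<Sum>\<sigma>\<in>E. \<sigma> (\<alpha> i) ^ j))"
      by (subst sum.swap) (simp add: sum_distrib_left)
    also have "\<dots> = (\<Sum>i=1..k. of_int (b i) * (of_nat m * (\<Sum>z\<in>C. z ^ j)))"
      using sum_embeddings_conjugate(1)[OF alg, where g = "\<lambda>z. z ^ j"] \<alpha>K
      by (intro sum.cong) (auto simp: E_def K_def C_def m_def)
    also have "\<dots> = (\<Sum>i=1..k. of_int (b i)) * (of_nat m * (\<Sum>z\<in>C. z ^ j))"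
      by (simp only: sum_distrib_right)
    also have "\<dots> = of_int (n * int m) * (\<Sum>z\<in>C. z ^ j)"
      by (simp add: n_def)
    finally show ?thesis .
  qed
  have n0: "n \<noteq> 0" using assms(5) by (simp add: n_def)
  define X where "X = real_of_int (\<bar>n\<bar> * int d)"
  have X1: "X \<ge> 1"
  proof -
    have "\<bar>n\<bar> * int d \<ge> 1" using n0 d0 by (metis abs_ge_zero abs_zero int_one_le_iff_zero_less mult_pos_pos of_nat_0_less_iff zero_less_abs_iff)
    then show ?thesis unfolding X_def by linarith
  qed
  \<comment> \<open>The floor is nonnegative because \<open>X \<ge> 1\<close>, so \<open>nat\<close>
    loses nothing.\<close>
  define v where "v = nat \<lfloor>log 2 X\<rfloor>"
  have v: "int v = \<lfloor>log 2 X\<rfloor>" using X1 by (simp add: v_def)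
  have "log 2 X < real (Suc v)" using v by linarith
  then have "X < 2 powr real (Suc v)" using X1 by (simp add: log_less_iff)
  then have "X < 2 ^ Suc v" by (simp only: powr_realpow zero_less_numeral)
  then have "real_of_int (\<bar>n\<bar> * int d) < real_of_int (2 ^ Suc v)" by (simp add: X_def)
  then have bound: "\<bar>n\<bar> * int d < 2 ^ Suc v" by (simp only: of_int_less_iff)
  have "algebraic_int z" if "z \<in> C" for z
  proof (rule algebraic_int_if_power_sum_window[OF finC, where N = "n * int m" and v = v])
    show "(\<Prod>z\<in>C. [:- z, 1:]) \<in> poly_over \<rat>"
      unfolding C_def prod_galois_conjugates[OF alg] by (rule rpoly_over_Rats)
    show "n * int m \<noteq> 0" using n0 m0 by simp
    \<comment> \<open>The product \<open>m * k\<close> is the number of embeddings, which is at most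
      \<open>d\<close>; this is how \<open>d\<close> enters the logarithm.\<close>
    have "\<bar>n * int m\<bar> * int (card C) = \<bar>n\<bar> * int (card E)"
      by (simp add: abs_mult cardC Emk)
    also have "\<dots> \<le> \<bar>n\<bar> * int d" using Ed by (intro mult_left_mono) auto
    finally show "\<bar>n * int m\<bar> * int (card C) < 2 ^ Suc v" using bound by simp
    show "z \<in> C" by fact
    fix j assume j: "card C * v < j" "j \<le> card C * v + card C"
    \<comment> \<open>As \<open>k \<le> d\<close>, the whole window of \<open>k\<close> exponents
      lies in the range of the hypothesis.\<close>
    have "card C * v + card C \<le> d * v + d" using kd by (simp add: cardC add_mono mult_le_mono1)
    then have "j \<le> d * v + d" using j by simp
    then have "int j \<le> int d + int d * \<lfloor>log 2 X\<rfloor> + 1"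
      unfolding v[symmetric] of_nat_mult[symmetric] of_nat_add[symmetric] by linarith
    then have "field_trace K (\<Sum>i=1..k. of_int (b i) * \<alpha> i ^ j) \<in> \<int>"
      using assms(6) j unfolding X_def n_def d_def K_def a_def by simp
    then show "of_int (n * int m) * (\<Sum>z\<in>C. z ^ j) \<in> \<int>" by (simp only: trace)
  qed
  then show ?thesis using bij aC by (auto simp: bij_betw_def a_def)
qed

end
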